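(* Let $\mathfrak{n}$ be a real nilpotent Lie algebra of dimension $n$ with Lie bracket $[\cdot,\cdot]$, endowed with a nice basis $\{e_1,\dots,e_n\}$. Then the open convex cone in $\mathfrak{d}$ given by $$\left(\mathbb{R}_{>0}\operatorname{CH}_{[\cdot,\cdot]}+\mathfrak{t}^n_{>0}\right)\cap\{D\in\mathfrak{d}:\operatorname{tr}D>0\}$$ is contained in $\mathfrak{d}_{RN}$.
   Context: Nice basis: a basis $\{e_1,\dots,e_n\}$ of a Lie algebra is nice if every bracket $[e_i,e_j]$ is a scalar multiple of some element $e_k$ of the basis, and two different brackets $[e_i,e_j]$, $[e_r,e_s]$ can be a nonzero multiple of the same $e_k$ only if $\{i,j\}$ and $\{r,s\}$ are either equal or disjoint. Notation: operators on $\mathfrak{n}$ are identified with $n\times n$ matrices via the basis. $\mathfrak{t}^n$ is the space of real diagonal $n\times n$ matrices, $\mathfrak{t}^n_{>0}$ the subset of those with all diagonal entries positive, and $\mathfrak{d}=\operatorname{Der}(\mathfrak{n})\cap\mathfrak{t}^n$ the space of diagonal derivations. $\mathfrak{d}_{RN}$ is the set of all $D\in\mathfrak{d}$ that are Ricci negative. Let $E_{rs}$ be the matrix whose only nonzero entry is a $1$ at position $(r,s)$, $F_{ij}^k=E_{kk}-E_{ii}-E_{jj}$ for $i<j$, and let $c_{ij}^k$ be the structure constants, $[e_i,e_j]=\sum_k c_{ij}^k e_k$. Then $\operatorname{CH}_{[\cdot,\cdot]}\subset\mathfrak{t}^n$ is the convex hull of $\{F_{ij}^k: i<j,\ c_{ij}^k\neq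 0\}$. For sets, $\mathbb{R}_{>0}A+B=\{ra+b:r>0,a\in A,b\in B\}$. Ricci negative derivation: for $D\in\operatorname{Der}(\mathfrak{n})$ let $\mathfrak{s}=\mathbb{R}f\oplus\mathfrak{n}$ be the solvable Lie algebra given by the semidirect sum with $\operatorname{ad} f|_{\mathfrak{n}}=D$. A derivation $D$ with $\operatorname{tr}D>0$ is called Ricci negative if $\mathfrak{s}$ admits an inner product such that $D$ is symmetric with respect to it ($D^t=D$), $f\perp\mathfrak{n}$, and the corresponding left-invariant metric on the simply connected Lie group with Lie algebra $\mathfrak{s}$ has negative definite Ricci curvature. *)

theory Defs
  imports "HOL-Analysis.Analysis"
begin

section \<open>Real Lie algebras\<close>

definition lie_algebra :: "('a::real_vector \<Rightarrow> 'a \<Rightarrow> 'a) \<Rightarrow> bool" where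
  "lie_algebra br \<longleftrightarrow>
     bilinear br \<and>
     (\<forall>x. br x x = 0) \<and>
     (\<forall>x y z. br x (br y z) + br y (br z x) + br z (br x y) = 0)"

primrec lower_central :: "('a::real_vector \<Rightarrow> 'a \<Rightarrow> 'a) \<Rightarrow> nat \<Rightarrow> 'a set" where
  "lower_central br 0 = UNIV"
| "lower_central br (Suc m) = span {br x y | x y. y \<in> lower_central br m}"

definition nilpotent_lie :: "('a::real_vector \<Rightarrow> 'a \<Rightarrow> 'a) \<Rightarrow> bool" where
  "nilpotent_lie br \<longleftrightarrow> (\<exists>m. lower_central br m = {0})"

definition derivation :: "('a::real_vector \<Rightarrow> 'a \<Rightarrow> 'a) \<Rightarrow> ('a \<Rightarrow> 'a) \<Rightarrow> bool" where
  "derivation br D \<longleftrightarrow>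
     linear D \<and> (\<forall>x y. D (br x y) = br (D x) y + br x (D y))"

text \<open>The semidirect sum of \<open>\<real>f\<close> and the Lie algebra \<open>(UNIV, br)\<close> with \<open>ad f = D\<close> on the
  latter.  The pair \<open>(s, x)\<close> stands for \<open>s f + x\<close>, so that \<open>f\<close> is \<open>(1, 0)\<close>.\<close>

definition semidirect ::
    "('a::real_vector \<Rightarrow> 'a \<Rightarrow> 'a) \<Rightarrow> ('a \<Rightarrow> 'a) \<Rightarrow> real \<times> 'a \<Rightarrow> real \<times> 'a \<Rightarrow> real \<times> 'a" where
  "semidirect br D u v = (0, fst u *\<^sub>R D (snd v) - fst v *\<^sub>R D (snd u) + br (snd u) (snd v))"

lemma bilinearI:
  assumes "\<And>x. linear (f x)" "\<And>y. linear (\<lambda>x. f x y)"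
  shows "bilinear f"
  using assms by (simp add: bilinear_def)

lemma lie_algebra_semidirect:
  assumes L: "lie_algebra br" and D: "derivation br D"
  shows "lie_algebra (semidirect br D)"
proof -
  have bil: "bilinear br" and alt: "\<And>x. br x x = 0"
    and jac: "\<And>x y z. br x (br y z) + br y (br z x) + br z (br x y) = 0"
    using L by (auto simp: lie_algebra_def)
  have lin: "linear D" and leib: "\<And>x y. D (br x y) = br (D x) y + br x (D y)"
    using D by (auto simp: derivation_def)
  note br_simps = bilinear_ladd[OF bil] bilinear_radd[OF bil] bilinear_lmul[OF bil]
    bilinear_rmul[OF bil] bilinear_lsub[OF bil] bilinear_rsub[OF bil]
  note D_simps = linear_add[OF lin] linear_diff[OF lin] linear_scale[OF lin]
  have skew: "br x y = - br y x" for x y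
    using alt[of "x + y"] alt[of x] alt[of y]
    by (simp add: bilinear_ladd[OF bil] bilinear_radd[OF bil] eq_neg_iff_add_eq_0 add.commute)
  have "bilinear (semidirect br D)"
    by (intro bilinearI linearI)
      (auto simp: semidirect_def br_simps D_simps algebra_simps)
  moreover have "semidirect br D x x = 0" for x
    by (simp add: semidirect_def alt prod_eq_iff)
  moreover have "semidirect br D x (semidirect br D y z) + semidirect br D y (semidirect br D z x)
      + semidirect br D z (semidirect br D x y) = 0" for x y z
  proof -
    obtain r a s b t c where [simp]: "x = (r, a)" "y = (s, b)" "z = (t, c)"
      by (metis surj_pair)
    have 1: "br a (br b c) = - br b (br c a) - br c (br a b)"
      using jac[of a b c] by (simp add: algebra_simps eq_neg_iff_add_eq_0)
    have 2: "br b (D a) = - br (D a) b" "br a (D c) = - br (D c) a" "br c (D b) = - br (D b) c"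
      by (rule skew)+
    have "snd (semidirect br D x (semidirect br D y z) + semidirect br D y (semidirect br D z x)
      + semidirect br D z (semidirect br D x y)) = 0"
      by (simp add: semidirect_def br_simps D_simps leib 1 2 scaleR_add_right scaleR_diff_right
          mult.commute) (simp add: algebra_simps)?
    then show ?thesis
      by (simp add: semidirect_def prod_eq_iff)
  qed
  ultimately show ?thesis
    by (simp add: lie_algebra_def)
qed


section \<open>Trace of an operator\<close>

text \<open>The choice of basis is immaterial, see \<open>op_trace_eq\<close> below.\<close>

definition op_trace :: "('a::real_vector \<Rightarrow> 'a) \<Rightarrow> real" where
  "op_trace T = (let B = (SOME B. independent B \<and> span B = UNIV)
                 in \<Sum>b\<in>B. representation B (T b) b)"

lemma op_trace_eq:
  fixes T :: "'a::real_vector \<Rightarrow> 'a"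
  assumes T: "linear T" and C: "independent C" "span C = UNIV" "finite C"
  shows "op_trace T = (\<Sum>c\<in>C. representation C (T c) c)"
proof -
  define B where "B = (SOME B :: 'a set. independent B \<and> span B = UNIV)"
  have "independent B \<and> span B = UNIV"
    unfolding B_def by (rule someI[where x = C]) (use C in auto)
  then have B: "independent B" "span B = UNIV"
    by auto
  have finB: "finite B"
    using independent_span_bound[OF C(3) B(1)] C(2) by auto
  define P where "P = (\<lambda>v b. representation B v b)"
  define Q where "Q = (\<lambda>v c. representation C v c)"
  have linP: "linear (\<lambda>v. P v b)" for b
    using real_vector.linear_representation[OF B]
    by (simp add: linear_def real_scaleR_def[abs_def] P_def)
  have linQ: "linear (\<lambda>v. Q v c)" for c
    using real_vector.linear_representation[OF C(1,2)]
    by (simp add: linear_def real_scaleR_def[abs_def] Q_def)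
  have expB: "(\<Sum>b\<in>B. P v b *\<^sub>R b) = v" for v
    using real_vector.sum_representation_eq[OF B(1) _ finB] B(2) by (simp add: P_def)
  have expC: "(\<Sum>c\<in>C. Q v c *\<^sub>R c) = v" for v
    using real_vector.sum_representation_eq[OF C(1) _ C(3)] C(2) by (simp add: Q_def)
  have "(\<Sum>b\<in>B. P (T b) b) = (\<Sum>b\<in>B. \<Sum>c\<in>C. Q (T b) c * P c b)"
  proof (rule sum.cong[OF refl])
    fix b
    have "P (T b) b = P (\<Sum>c\<in>C. Q (T b) c *\<^sub>R c) b"
      by (simp add: expC)
    then show "P (T b) b = (\<Sum>c\<in>C. Q (T b) c * P c b)"
      by (simp add: linear_sum[OF linP] linear_scale[OF linP])
  qed
  also have "\<dots> = (\<Sum>c\<in>C. \<Sum>b\<in>B. P c b * Q (T b) c)"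
    by (subst sum.swap) (simp add: mult.commute)
  also have "\<dots> = (\<Sum>c\<in>C. Q (T c) c)"
  proof (rule sum.cong[OF refl])
    fix c
    have "Q (T c) c = Q (T (\<Sum>b\<in>B. P c b *\<^sub>R b)) c"
      by (simp add: expB)
    then show "(\<Sum>b\<in>B. P c b * Q (T b) c) = Q (T c) c"
      by (simp add: linear_sum[OF T] linear_scale[OF T] linear_sum[OF linQ] linear_scale[OF linQ])
  qed
  finally show ?thesis
    by (simp add: op_trace_def B_def[symmetric] P_def Q_def)
qed


section \<open>Left-invariant metrics and their Ricci curvature\<close>

definition is_inner_product :: "('a::real_vector \<Rightarrow> 'a \<Rightarrow> real) \<Rightarrow> bool" where
  "is_inner_product g \<longleftrightarrow>
     bilinear g \<and> (\<forall>x y. g x y = g y x) \<and> (\<forall>x. x \<noteq> 0 \<longrightarrow> g x x > 0)"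

text \<open>On a Lie group with a left-invariant metric, all tensors below are left-invariant and hence
  determined by their values on left-invariant vector fields, i.e. by tensors on the Lie algebra.
  For left-invariant \<open>X\<close>, \<open>Y\<close>, \<open>Z\<close> the function \<open>g Y Z\<close> is constant, so the metric condition
  \<open>X (g Y Z) = g (\<nabla> X Y) Z + g Y (\<nabla> X Z)\<close> becomes the last conjunct.\<close>

definition is_levi_civita ::
    "('a::real_vector \<Rightarrow> 'a \<Rightarrow> 'a) \<Rightarrow> ('a \<Rightarrow> 'a \<Rightarrow> real) \<Rightarrow> ('a \<Rightarrow> 'a \<Rightarrow> 'a) \<Rightarrow> bool" where
  "is_levi_civita br g nab \<longleftrightarrow>
     bilinear nab \<and>
     (\<forall>x y. nab x y - nab y x = br x y) \<and>
     (\<forall>x y z. g (nab x y) z + g y (nab x z) = 0)"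

definition levi_civita ::
    "('a::real_vector \<Rightarrow> 'a \<Rightarrow> 'a) \<Rightarrow> ('a \<Rightarrow> 'a \<Rightarrow> real) \<Rightarrow> 'a \<Rightarrow> 'a \<Rightarrow> 'a" where
  "levi_civita br g = (THE nab. is_levi_civita br g nab)"

definition curvature ::
    "('a::real_vector \<Rightarrow> 'a \<Rightarrow> 'a) \<Rightarrow> ('a \<Rightarrow> 'a \<Rightarrow> real) \<Rightarrow> 'a \<Rightarrow> 'a \<Rightarrow> 'a \<Rightarrow> 'a" where
  "curvature br g x y z =
     (let nab = levi_civita br g
      in nab x (nab y z) - nab y (nab x z) - nab (br x y) z)"

definition ricci ::
    "('a::real_vector \<Rightarrow> 'a \<Rightarrow> 'a) \<Rightarrow> ('a \<Rightarrow> 'a \<Rightarrow> real) \<Rightarrow> 'a \<Rightarrow> 'a \<Rightarrow> real" where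
  "ricci br g y z = op_trace (\<lambda>x. curvature br g x y z)"

definition negative_definite :: "('a::real_vector \<Rightarrow> 'a \<Rightarrow> real) \<Rightarrow> bool" where
  "negative_definite q \<longleftrightarrow> (\<forall>x. x \<noteq> 0 \<longrightarrow> q x x < 0)"

lemma koszul:
  assumes g: "is_inner_product g" and n: "is_levi_civita br g nab"
  shows "2 * g (nab x y) z = g (br x y) z - g (br y z) x + g (br z x) y"
proof -
  have bil: "bilinear g" and sym: "\<And>x y. g x y = g y x"
    using g by (auto simp: is_inner_product_def)
  have tor: "br x y = nab x y - nab y x" for x y
    using n by (simp add: is_levi_civita_def)
  have met: "g (nab x y) z = - g (nab x z) y" for x y z
  proof -
    have "g (nab x y) z + g y (nab x z) = 0"
      using n by (simp add: is_levi_civita_def)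
    then show ?thesis
      using sym[of y "nab x z"] by linarith
  qed
  show ?thesis
    using met[of x y z] met[of y x z] met[of z x y]
    by (simp add: tor bilinear_lsub[OF bil])
qed

lemma inner_product_eqI:
  assumes g: "is_inner_product g" and eq: "\<And>z. g v z = g w z"
  shows "v = w"
proof (rule ccontr)
  assume "v \<noteq> w"
  then have "g (v - w) (v - w) > 0"
    using g by (simp add: is_inner_product_def)
  moreover have "g (v - w) (v - w) = 0"
    using g eq[of "v - w"] by (simp add: is_inner_product_def bilinear_lsub)
  ultimately show False
    by simp
qed

lemma inner_product_riesz:
  fixes g :: "'a::real_vector \<Rightarrow> 'a \<Rightarrow> real" and B :: "'a set"
  assumes g: "is_inner_product g" and B: "finite B" "independent B" "span B = UNIV"
    and p: "linear p"
  shows "\<exists>w. \<forall>z. g w z = p z"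
proof -
  have bil: "bilinear g"
    using g by (simp add: is_inner_product_def)
  have lr: "linear (\<lambda>z. g v z)" and ll: "linear (\<lambda>z. g z v)" for v
    using bil by (auto simp: bilinear_def)
  interpret fd: finite_dimensional_vector_space "scaleR :: real \<Rightarrow> 'a \<Rightarrow> 'a" B
    using B by unfold_locales (auto simp: dependent_raw_def span_raw_def)
  define T where "T = (\<lambda>w. \<Sum>b\<in>B. g w b *\<^sub>R b)"
  have linT: "linear T"
    unfolding T_def
    by (intro linearI)
      (simp_all add: linear_add[OF ll] linear_scale[OF ll] scaleR_add_left sum.distrib scaleR_sum_right)
  have eqB: "g w z = q z" if "linear q" "\<And>b. b \<in> B \<Longrightarrow> g w b = q b" for w q z
    using linear_eq_on[OF lr that(1), of z B w] that(2) B(3) by auto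
  have coeff: "u b = v b" if "(\<Sum>b\<in>B. u b *\<^sub>R b) = (\<Sum>b\<in>B. v b *\<^sub>R b)" "b \<in> B" for u v b
  proof -
    have "(\<Sum>b\<in>B. (u b - v b) *\<^sub>R b) = 0"
      using that(1) by (simp add: scaleR_diff_left sum_subtractf)
    then show ?thesis
      using independentD[OF B(2) B(1) subset_refl, of "\<lambda>b. u b - v b" b] that(2) by auto
  qed
  have "inj T"
  proof (rule injI)
    fix v w
    assume "T v = T w"
    then have "g v b = g w b" if "b \<in> B" for b
      using coeff[of "g v" "g w" b] that by (simp add: T_def)
    then have "g v z = g w z" for z
      by (rule eqB[OF lr])
    then show "v = w"
      by (rule inner_product_eqI[OF g])
  qed
  then have "surj T"
    using fd.linear_inj_imp_surj[of T] linT by (simp add: linear_def)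
  then obtain w where "T w = (\<Sum>b\<in>B. p b *\<^sub>R b)"
    by (metis surjD)
  then have "g w b = p b" if "b \<in> B" for b
    using coeff[of "g w" p b] that by (simp add: T_def)
  then show ?thesis
    using eqB[OF p] by blast
qed

lemma levi_civita:
  fixes br :: "'a::real_vector \<Rightarrow> 'a \<Rightarrow> 'a" and B :: "'a set"
  assumes L: "lie_algebra br" and g: "is_inner_product g"
    and B: "finite B" "independent B" "span B = UNIV"
  shows "is_levi_civita br g (levi_civita br g)"
proof -
  have bil: "bilinear g" and sym: "\<And>x y. g x y = g y x"
    using g by (auto simp: is_inner_product_def)
  have bbr: "bilinear br" and alt: "\<And>x. br x x = 0"
    using L by (auto simp: lie_algebra_def)
  note br_simps = bilinear_ladd[OF bbr] bilinear_radd[OF bbr] bilinear_lmul[OF bbr]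
    bilinear_rmul[OF bbr]
  note g_simps = bilinear_ladd[OF bil] bilinear_radd[OF bil] bilinear_lmul[OF bil]
    bilinear_rmul[OF bil]
  have skew: "br x y = - br y x" for x y
    using alt[of "x + y"] alt[of x] alt[of y]
    by (simp add: br_simps eq_neg_iff_add_eq_0 add.commute)
  have gskew: "g (br x y) z = - g (br y x) z" for x y z
    using skew[of x y] by (simp add: bilinear_lneg[OF bil])
  define p where "p = (\<lambda>x y z. (g (br x y) z - g (br y z) x + g (br z x) y) / 2)"
  have "linear (p x y)" for x y
    by (intro linearI) (simp_all add: p_def br_simps g_simps field_simps)
  then have "\<forall>x y. \<exists>w. \<forall>z. g w z = p x y z"
    using inner_product_riesz[OF g B] by blast
  then obtain nab where nab: "\<And>x y z. g (nab x y) z = p x y z"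
    by metis
  have "bilinear nab"
    by (intro bilinearI linearI; rule inner_product_eqI[OF g])
      (simp_all add: nab g_simps, simp_all add: p_def br_simps g_simps field_simps)
  moreover have "nab x y - nab y x = br x y" for x y
  proof (rule inner_product_eqI[OF g])
    fix z
    show "g (nab x y - nab y x) z = g (br x y) z"
      using gskew[of y x z] gskew[of z x y] gskew[of z y x]
      by (simp add: bilinear_lsub[OF bil] nab p_def field_simps)
  qed
  moreover have "g (nab x y) z + g y (nab x z) = 0" for x y z
    using gskew[of y x z] gskew[of z x y] gskew[of z y x] sym[of y "nab x z"]
    by (simp add: nab p_def field_simps)
  ultimately have ex: "is_levi_civita br g nab"
    by (simp add: is_levi_civita_def)
  have "nab' = nab" if n: "is_levi_civita br g nab'" for nab'
  proof (intro ext inner_product_eqI[OF g])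
    fix x y z
    show "g (nab' x y) z = g (nab x y) z"
      using koszul[OF g n, of x y z] koszul[OF g ex, of x y z] by simp
  qed
  then show ?thesis
    unfolding levi_civita_def by (rule theI[of "is_levi_civita br g" nab, OF ex])
qed


section \<open>Ricci negative derivations\<close>

definition ricci_negative ::
    "('a::real_vector \<Rightarrow> 'a \<Rightarrow> 'a) \<Rightarrow> ('a \<Rightarrow> 'a) \<Rightarrow> bool" where
  "ricci_negative br D \<longleftrightarrow>
     derivation br D \<and> op_trace D > 0 \<and>
     (\<exists>g. is_inner_product g \<and>
          (\<forall>x y. g (0, D x) (0, y) = g (0, x) (0, D y)) \<and>
          (\<forall>x. g (1, 0) (0, x) = 0) \<and>
          negative_definite (ricci (semidirect br D) g))"


section \<open>Nice bases and diagonal derivations\<close>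

definition is_basis :: "('n::finite \<Rightarrow> 'a::real_vector) \<Rightarrow> bool" where
  "is_basis e \<longleftrightarrow> inj e \<and> independent (range e) \<and> span (range e) = UNIV"

definition nice_basis :: "('a::real_vector \<Rightarrow> 'a \<Rightarrow> 'a) \<Rightarrow> ('n::finite \<Rightarrow> 'a) \<Rightarrow> bool" where
  "nice_basis br e \<longleftrightarrow>
     is_basis e \<and>
     (\<forall>i j. \<exists>k a. br (e i) (e j) = a *\<^sub>R e k) \<and>
     (\<forall>i j r s k.
        (\<exists>a. a \<noteq> 0 \<and> br (e i) (e j) = a *\<^sub>R e k) \<and>
        (\<exists>b. b \<noteq> 0 \<and> br (e r) (e s) = b *\<^sub>R e k) \<longrightarrow>
        {i, j} = {r, s} \<or> {i, j} \<inter> {r, s} = {})"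

definition struct_const ::
    "('a::real_vector \<Rightarrow> 'a \<Rightarrow> 'a) \<Rightarrow> ('n::finite \<Rightarrow> 'a) \<Rightarrow> 'n \<Rightarrow> 'n \<Rightarrow> 'n \<Rightarrow> real" where
  "struct_const br e i j k = representation (range e) (br (e i) (e j)) (e k)"

definition op_of_matrix :: "('n::finite \<Rightarrow> 'a::real_vector) \<Rightarrow> real^'n^'n \<Rightarrow> 'a \<Rightarrow> 'a" where
  "op_of_matrix e A x =
     (\<Sum>i\<in>UNIV. \<Sum>j\<in>UNIV. (A $ i $ j * representation (range e) x (e j)) *\<^sub>R e i)"

definition diag_matrices :: "(real^'n^'n) set" where
  "diag_matrices = {A. \<forall>i j. i \<noteq> j \<longrightarrow> A $ i $ j = 0}"

definition pos_diag_matrices :: "(real^'n^'n) set" where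
  "pos_diag_matrices = {A \<in> diag_matrices. \<forall>i. A $ i $ i > 0}"

definition diag_derivations ::
    "('a::real_vector \<Rightarrow> 'a \<Rightarrow> 'a) \<Rightarrow> ('n::finite \<Rightarrow> 'a) \<Rightarrow> (real^'n^'n) set" where
  "diag_derivations br e = {A \<in> diag_matrices. derivation br (op_of_matrix e A)}"

definition diag_ricci_negative ::
    "('a::real_vector \<Rightarrow> 'a \<Rightarrow> 'a) \<Rightarrow> ('n::finite \<Rightarrow> 'a) \<Rightarrow> (real^'n^'n) set" where
  "diag_ricci_negative br e =
     {A \<in> diag_derivations br e. ricci_negative br (op_of_matrix e A)}"

definition matrix_unit :: "'n::finite \<Rightarrow> 'n \<Rightarrow> real^'n^'n" where
  "matrix_unit r s = (\<chi> i j. if i = r \<and> j = s then 1 else 0)"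

definition F_matrix :: "'n::finite \<Rightarrow> 'n \<Rightarrow> 'n \<Rightarrow> real^'n^'n" where
  "F_matrix i j k = matrix_unit k k - matrix_unit i i - matrix_unit j j"

definition CH ::
    "('a::real_vector \<Rightarrow> 'a \<Rightarrow> 'a) \<Rightarrow> ('n \<Rightarrow> 'a) \<Rightarrow> (real^('n::{finite,linorder})^('n::{finite,linorder})) set" where
  "CH br e = convex hull {F_matrix i j k | i j k. i < j \<and> struct_const br e i j k \<noteq> 0}"

text \<open>The set \<open>\<real>\<^sub>>\<^sub>0 A + B\<close>; the scalar \<open>0\<close> is excluded, so it is empty if \<open>A\<close> is.\<close>

definition pos_ray_plus :: "'v::real_vector set \<Rightarrow> 'v set \<Rightarrow> 'v set" where
  "pos_ray_plus A B = {r *\<^sub>R a + b | r a b. r > 0 \<and> a \<in> A \<and> b \<in> B}"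

text \<open>Closed under positive scalars only, unlike \<open>cone\<close> and \<open>conic\<close>, which also force \<open>0\<close>
  into nonempty sets.\<close>

definition pos_cone :: "'v::real_vector set \<Rightarrow> bool" where
  "pos_cone S \<longleftrightarrow> (\<forall>x\<in>S. \<forall>r>0. r *\<^sub>R x \<in> S)"

end

(*
  Take D = r a + P with a in CH and P positive diagonal.  A diagonal metric makes the rescaled basis
  exp(-x_i/2) e_i orthonormal; its structure constants satisfy C_ijk^2 = c_ijk^2 exp(x_k - x_i - x_j).
  For such a metric with |f|^2 = 2 tr D the Ricci operator is diagonal: niceness kills the
  off-diagonal terms of the metric on n, and nilpotency rules out cross terms between the two
  directions i -> j and j -> i of ad.  It is negative in the direction f, and on n it equals
  (1/2) (sum_{i<j,k} C_ijk^2 F_ij^k - D).  It remains to find x with sum C_ijk^2 F_ij^k < D.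
  The sum is the gradient of the exponential sum G(x) = sum c_ijk^2 exp<F_ij^k, x>.  As r a is a
  nonnegative combination of the F_ij^k, the function G(x) - <r a, x> is bounded below, so its
  gradient is arbitrarily small somewhere, in particular smaller than P.
*)

theory Submission
  imports Defs
begin

section \<open>Coordinate functionals of a basis, dual families, and the trace in
  coordinates\<close>

section \<open>Coordinates\<close>

definition coord :: "('n::finite \<Rightarrow> 'a::real_vector) \<Rightarrow> 'a \<Rightarrow> 'n \<Rightarrow> real" where
  "coord e x i = representation (range e) x (e i)"

lemma linear_coord: "is_basis e \<Longrightarrow> linear (\<lambda>x. coord e x i)"
  using real_vector.linear_representation[of "range e" "e i"]
  by (simp add: is_basis_def linear_def real_scaleR_def[abs_def] coord_def)

lemma coord_basis: "is_basis e \<Longrightarrow> coord e (e j) i = (if i = j then 1 else 0)"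
  by (auto simp: coord_def is_basis_def representation_basis inj_eq)

lemma sum_coord:
  assumes "is_basis e"
  shows "(\<Sum>i\<in>UNIV. coord e x i *\<^sub>R e i) = x"
proof -
  have "(\<Sum>b\<in>range e. representation (range e) x b *\<^sub>R b) = x"
    using assms by (intro real_vector.sum_representation_eq) (auto simp: is_basis_def)
  then show ?thesis
    using assms by (simp add: is_basis_def sum.reindex coord_def)
qed

lemma exists_coord_nonzero:
  assumes "is_basis e" and "x \<noteq> 0"
  shows "\<exists>i. coord e x i \<noteq> 0"
proof (rule ccontr)
  assume "\<nexists>i. coord e x i \<noteq> 0"
  then show False
    using sum_coord[OF assms(1), of x] assms(2) by simp
qed

lemma struct_const_coord: "struct_const br e i j k = coord e (br (e i) (e j)) k"
  by (simp add: struct_const_def coord_def)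

lemma linear_coord_expand:
  assumes "is_basis e" and lin: "linear q"
  shows "q x = (\<Sum>i\<in>UNIV. coord e x i *\<^sub>R q (e i))"
proof -
  have "q x = q (\<Sum>i\<in>UNIV. coord e x i *\<^sub>R e i)"
    using assms by (simp add: sum_coord)
  then show ?thesis
    by (simp add: linear_sum[OF lin] linear_scale[OF lin])
qed

lemma coord_diag_operator:
  assumes e: "is_basis e" and lin: "linear D" and diag: "\<And>i. D (e i) = d i *\<^sub>R e i"
  shows "coord e (D v) i = d i * coord e v i"
proof -
  have "coord e (D v) i = (\<Sum>j\<in>UNIV. coord e v j * (d j * (if i = j then 1 else 0)))"
    by (subst linear_coord_expand[OF e lin])
      (simp add: linear_sum[OF linear_coord[OF e]] linear_scale[OF linear_coord[OF e]] diag
        coord_basis[OF e] mult.assoc)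
  also have "\<dots> = d i * coord e v i"
    by (simp add: mult_delta_right)
  finally show ?thesis .
qed

text \<open>Applying the functional with index \<open>i\<close> to a vanishing linear combination
  isolates the \<open>i\<close>-th coefficient. The lemma serves orthonormal families, where the
  functionals are inner products, and rescaled bases.\<close>

lemma is_basis_dual:
  fixes e :: "'n::finite \<Rightarrow> 'a::real_vector"
  assumes lin: "\<And>i. linear (\<lambda>v. q v i)"
    and dual: "\<And>i j. q (e j) i = (if i = j then 1 else 0)"
    and span: "span (range e) = UNIV"
  shows "is_basis e" and "coord e v i = q v i"
proof -
  note lin_simps = linear_sum[OF lin] linear_scale[OF lin] linear_0[OF lin]
  have inj: "inj e"
    by (rule injI) (metis dual zero_neq_one)
  have "independent (range e)"
  proof (rule independent_if_scalars_zero)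
    fix f x
    assume 0: "(\<Sum>x\<in>range e. f x *\<^sub>R x) = 0" and x: "x \<in> range e"
    then obtain i where i: "x = e i"
      by auto
    have "(\<Sum>j\<in>UNIV. f (e j) *\<^sub>R e j) = 0"
      using 0 by (simp add: sum.reindex[OF inj])
    then have "q (\<Sum>j\<in>UNIV. f (e j) *\<^sub>R e j) i = 0"
      by (simp add: lin_simps)
    then show "f x = 0"
      by (simp add: lin_simps dual i mult_delta_right)
  qed simp
  with inj span show e: "is_basis e"
    by (simp add: is_basis_def)
  show "coord e v i = q v i"
    by (subst linear_coord_expand[OF e lin]) (simp add: dual mult_delta_right)
qed

lemma op_trace_coord:
  assumes e: "is_basis e" and T: "linear T"
  shows "op_trace T = (\<Sum>i\<in>UNIV. coord e (T (e i)) i)"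
proof -
  have "op_trace T = (\<Sum>c\<in>range e. representation (range e) (T c) c)"
    using e by (intro op_trace_eq[OF T]) (auto simp: is_basis_def)
  also have "\<dots> = (\<Sum>i\<in>UNIV. coord e (T (e i)) i)"
    using e by (simp add: is_basis_def sum.reindex coord_def)
  finally show ?thesis .
qed

section \<open>The Ricci quadratic form of a left-invariant metric in terms of brackets\<close>

section \<open>Ricci curvature in an orthonormal basis\<close>

text \<open>Both sides are linear in \<open>v\<close> and agree on a spanning family, so
  independence of \<open>E\<close> need not be established first.\<close>

lemma orthonormal_expansion:
  fixes E :: "'m::finite \<Rightarrow> 'a::real_vector"
  assumes g: "is_inner_product g"
    and orth: "\<And>i j. g (E i) (E j) = (if i = j then 1 else 0)"
    and span: "span (range E) = UNIV"
  shows "(\<Sum>i\<in>UNIV. g v (E i) *\<^sub>R E i) = v"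
proof -
  have bil: "bilinear g"
    using g by (simp add: is_inner_product_def)
  define T where "T = (\<lambda>v. \<Sum>i\<in>UNIV. g v (E i) *\<^sub>R E i)"
  have "linear T"
    unfolding T_def
    by (intro linearI)
      (simp_all add: bilinear_ladd[OF bil] bilinear_lmul[OF bil] scaleR_add_left sum.distrib
        scaleR_sum_right)
  moreover have "T b = b" if "b \<in> range E" for b
    using that by (auto simp: T_def orth if_distrib[of "\<lambda>r. r *\<^sub>R _"] cong: if_cong)
  ultimately have "T v = v"
    using linear_eq_on[of T "\<lambda>x. x" v "range E"] span linear_ident by auto
  then show ?thesis
    by (simp add: T_def)
qed

lemma op_trace_orthonormal:
  fixes E :: "'m::finite \<Rightarrow> 'a::real_vector"
  assumes g: "is_inner_product g"
    and orth: "\<And>i j. g (E i) (E j) = (if i = j then 1 else 0)"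
    and span: "span (range E) = UNIV"
    and T: "linear T"
  shows "op_trace T = (\<Sum>i\<in>UNIV. g (T (E i)) (E i))"
proof -
  have "linear (\<lambda>v. g v w)" for w
    using g by (simp add: is_inner_product_def bilinear_def)
  from is_basis_dual[OF this _ span, of E] have "is_basis E" "\<And>v i. coord E v i = g v (E i)"
    by (auto simp: orth)
  then show ?thesis
    by (simp add: op_trace_coord[OF _ T])
qed

text \<open>The existence result \<open>levi_civita\<close> asks for a finite basis given as a set,
  whereas the metrics below come with spanning families indexed by a type.\<close>

lemma finite_spanning_basis:
  assumes "finite A" "span A = (UNIV :: 'a::real_vector set)"
  obtains B where "finite B" "independent B" "span B = (UNIV :: 'a set)"
proof -
  obtain B where "B \<subseteq> A" "independent B" "A \<subseteq> span B"
    by (metis basis_exists)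
  moreover from this have "span B = UNIV"
    using assms by (metis span_mono span_span top.extremum_uniqueI)
  ultimately show ?thesis
    using that finite_subset[of B A] assms by auto
qed

lemma lie_skew:
  assumes "lie_algebra br"
  shows "br x y = - br y x"
proof -
  have bil: "bilinear br" and alt: "\<And>x. br x x = 0"
    using assms by (auto simp: lie_algebra_def)
  show ?thesis
    using alt[of "x + y"] alt[of x] alt[of y]
    by (simp add: bilinear_ladd[OF bil] bilinear_radd[OF bil] eq_neg_iff_add_eq_0 add.commute)
qed

text \<open>This is the classical formula in which the terms \<open>- |ad y|^2 / 2\<close> and minus
  half the Killing form are merged: together they are minus a quarter of the squared norm of
  \<open>ad y\<close> plus its transpose. The last sum is the trace of \<open>ad\<close> of
  \<open>nab y y\<close>, the mean curvature term.\<close>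

lemma ricci_orthonormal:
  fixes E :: "'m::finite \<Rightarrow> 'a::real_vector"
  assumes L: "lie_algebra br" and g: "is_inner_product g"
    and orth: "\<And>i j. g (E i) (E j) = (if i = j then 1 else 0)"
    and span: "span (range E) = UNIV"
  shows "ricci br g y y =
    (\<Sum>i\<in>UNIV. \<Sum>j\<in>UNIV. (g (br (E i) (E j)) y)\<^sup>2) / 4
    - (\<Sum>i\<in>UNIV. \<Sum>j\<in>UNIV. (g (br y (E i)) (E j) + g (br y (E j)) (E i))\<^sup>2) / 4
    - (\<Sum>i\<in>UNIV. g (br (levi_civita br g y y) (E i)) (E i))"
proof -
  have bil: "bilinear g" and sym: "\<And>x y. g x y = g y x"
    using g by (auto simp: is_inner_product_def)
  have bbr: "bilinear br" and alt: "\<And>x. br x x = 0"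
    using L by (auto simp: lie_algebra_def)
  have gskew: "g (br x y) z = - g (br y x) z" for x y z
    using lie_skew[OF L, of x y] by (simp add: bilinear_lneg[OF bil])
  note expand = orthonormal_expansion[OF g orth span]
  obtain B :: "'a set" where B: "finite B" "independent B" "span B = UNIV"
    using finite_spanning_basis[OF _ span] by auto
  define nab where "nab = levi_civita br g"
  have lc: "is_levi_civita br g nab"
    unfolding nab_def by (rule levi_civita[OF L g B])
  have bn: "bilinear nab" and tor: "\<And>x y. br x y = nab x y - nab y x"
    and met: "\<And>x y z. g (nab x y) z + g y (nab x z) = 0"
    using lc by (auto simp: is_levi_civita_def)
  note kos = koszul[OF g lc]
  note bsimps = bilinear_ladd[OF bil] bilinear_lmul[OF bil] bilinear_lsub[OF bil]
    bilinear_radd[OF bil] bilinear_rmul[OF bil] bilinear_rsub[OF bil]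
    bilinear_ladd[OF bn] bilinear_lmul[OF bn] bilinear_lsub[OF bn]
    bilinear_radd[OF bn] bilinear_rmul[OF bn] bilinear_rsub[OF bn]
    bilinear_ladd[OF bbr] bilinear_lmul[OF bbr] bilinear_lsub[OF bbr]
    bilinear_radd[OF bbr] bilinear_rmul[OF bbr] bilinear_rsub[OF bbr]
  \<comment> \<open>\<open>N\<close> is the matrix of the map sending \<open>v\<close> to
    \<open>nab v y\<close>, and \<open>A\<close> that of \<open>nab y\<close>. Metric compatibility
    makes \<open>A\<close> skew, but \<open>N\<close> has no symmetry in general.\<close>
  define N where "N = (\<lambda>i j. g (nab (E i) y) (E j))"
  define A where "A = (\<lambda>i j. g (nab y (E i)) (E j))"
  have A_skew: "A i j = - A j i" for i j
    using met[of y "E i" "E j"] sym[of "E i" "nab y (E j)"] by (simp add: A_def)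
  have lin: "linear (\<lambda>x. curvature br g x y y)"
    unfolding curvature_def Let_def nab_def[symmetric]
    by (intro linearI) (simp_all add: bsimps algebra_simps)
  have prod: "g v w = (\<Sum>j\<in>UNIV. g v (E j) * g w (E j))" for v w
  proof -
    have "g v w = g v (\<Sum>j\<in>UNIV. g w (E j) *\<^sub>R E j)"
      by (simp add: expand)
    moreover have "linear (g v)"
      using bil by (simp add: bilinear_def)
    ultimately show ?thesis
      by (simp add: linear_sum linear_scale mult.commute)
  qed
  have nabN: "g (nab v y) (E i) = (\<Sum>j\<in>UNIV. g v (E j) * N j i)" for v i
  proof -
    have "g (nab v y) (E i) = g (nab (\<Sum>j\<in>UNIV. g v (E j) *\<^sub>R E j) y) (E i)"
      by (simp add: expand)
    moreover have lin: "linear (\<lambda>v. g (nab v y) (E i))"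
      by (intro linearI) (simp_all add: bsimps)
    ultimately show ?thesis
      by (simp add: linear_sum[OF lin] linear_scale[OF lin] N_def)
  qed
  \<comment> \<open>The three terms of the curvature are treated separately: Koszul for
    \<open>nab (E i) (nab y y)\<close>, metric compatibility for \<open>nab y (nab (E i) y)\<close>,
    and vanishing torsion, which splits \<open>br (E i) y\<close> into a row of \<open>N\<close>
    minus a row of \<open>A\<close>.\<close>
  have curv: "g (curvature br g (E i) y y) (E i)
      = - g (br (nab y y) (E i)) (E i) + (\<Sum>j\<in>UNIV. A i j * N j i + A i j * N i j - N i j * N j i)" for i
  proof -
    have "g (nab (E i) (nab y y)) (E i) = - g (br (nab y y) (E i)) (E i)"
      using kos[of "E i" "nab y y" "E i"] alt gskew[of "nab y y" "E i" "E i"]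
      by (simp add: bilinear_lzero[OF bil])
    moreover have "- g (nab y (nab (E i) y)) (E i) = (\<Sum>j\<in>UNIV. A i j * N i j)"
      using met[of y "nab (E i) y" "E i"] prod[of "nab (E i) y" "nab y (E i)"]
      by (simp add: A_def N_def mult.commute)
    moreover have "- g (nab (br (E i) y) y) (E i) = (\<Sum>j\<in>UNIV. A i j * N j i - N i j * N j i)"
      unfolding nabN by (simp add: tor bsimps A_def N_def algebra_simps sum_negf[symmetric])
    ultimately show ?thesis
      by (simp add: curvature_def Let_def nab_def[symmetric] bsimps sum.distrib sum_subtractf)
  qed
  \<comment> \<open>Exchanging \<open>i\<close> and \<open>j\<close> and using skewness of
    \<open>A\<close>, the mixed terms in \<open>curv\<close> cancel once summed over
    \<open>i\<close>; only the products \<open>N i j * N j i\<close> survive.\<close>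
  have cancel: "(\<Sum>i\<in>UNIV. \<Sum>j\<in>UNIV. A i j * N j i) = - (\<Sum>i\<in>UNIV. \<Sum>j\<in>UNIV. A i j * N i j)"
    by (subst sum.swap, subst A_skew) (simp add: sum_negf)
  \<comment> \<open>\<open>N\<close> splits into its symmetric part, given by \<open>ad y\<close>, and its skew part \<open>- g [E i, E j] y / 2\<close>.\<close>
  have NN: "N i j * N j i = ((g (br y (E i)) (E j) + g (br y (E j)) (E i))\<^sup>2 - (g (br (E i) (E j)) y)\<^sup>2) / 4"
    for i j
  proof -
    define a b k where "a = g (br y (E i)) (E j)" and "b = g (br y (E j)) (E i)"
      and "k = g (br (E i) (E j)) y"
    have N: "N i j = (- a - b - k) / 2" "N j i = (- a - b + k) / 2"
      using kos[of "E i" y "E j"] kos[of "E j" y "E i"] gskew[of "E i" y "E j"]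
        gskew[of "E j" y "E i"] gskew[of "E j" "E i" y]
      by (simp_all add: N_def a_def b_def k_def)
    show ?thesis
      unfolding N a_def[symmetric] b_def[symmetric] k_def[symmetric]
      by (simp add: field_simps power2_eq_square)
  qed
  have "ricci br g y y = (\<Sum>i\<in>UNIV. g (curvature br g (E i) y y) (E i))"
    unfolding ricci_def by (rule op_trace_orthonormal[OF g orth span lin])
  also have "\<dots> = - (\<Sum>i\<in>UNIV. g (br (nab y y) (E i)) (E i))
      - (\<Sum>i\<in>UNIV. \<Sum>j\<in>UNIV. N i j * N j i)"
    by (simp add: curv sum.distrib sum_subtractf sum_negf cancel)
  finally show ?thesis
    by (simp add: NN nab_def sum_divide_distrib[symmetric] sum_subtractf diff_divide_distrib)
qed

section \<open>The Ricci form on the semidirect sum, for metrics diagonal in the basis\<close>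

section \<open>Diagonal metrics on semidirect sums\<close>

text \<open>The vector \<open>f\<close> is kept fixed by \<open>ad f = D\<close>, so its squared
  length \<open>h\<close> is a free parameter; it sets the weight of \<open>D\<close> in the Ricci
  form.\<close>

definition diag_metric ::
    "real \<Rightarrow> ('n::finite \<Rightarrow> 'a::real_vector) \<Rightarrow> real \<times> 'a \<Rightarrow> real \<times> 'a \<Rightarrow> real" where
  "diag_metric h e u v =
     h * fst u * fst v + (\<Sum>i\<in>UNIV. coord e (snd u) i * coord e (snd v) i)"

lemma is_inner_product_diag_metric:
  assumes e: "is_basis e" and h: "h > 0"
  shows "is_inner_product (diag_metric h e)"
proof -
  note simps = linear_add[OF linear_coord[OF e]] linear_scale[OF linear_coord[OF e]]
  have "bilinear (diag_metric h e)"
    by (intro bilinearI linearI)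
      (simp_all add: diag_metric_def simps algebra_simps sum.distrib sum_distrib_left)
  moreover have "diag_metric h e x y = diag_metric h e y x" for x y
    by (simp add: diag_metric_def mult_ac)
  moreover have "diag_metric h e x x > 0" if "x \<noteq> 0" for x
  proof -
    have nonneg: "h * (fst x)\<^sup>2 \<ge> 0" "(\<Sum>i\<in>UNIV. (coord e (snd x) i)\<^sup>2) \<ge> 0"
      using h by (auto intro: sum_nonneg)
    have "h * (fst x)\<^sup>2 > 0 \<or> (\<Sum>i\<in>UNIV. (coord e (snd x) i)\<^sup>2) > 0"
    proof (cases "fst x = 0")
      case True
      then have "snd x \<noteq> 0"
        using that by (metis prod.collapse zero_prod_def)
      then obtain i where "coord e (snd x) i \<noteq> 0"
        using exists_coord_nonzero[OF e] by blast
      then show ?thesis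
        by (intro disjI2 sum_pos2[where i = i]) auto
    qed (use h in simp)
    then show ?thesis
      using nonneg by (auto simp: diag_metric_def power2_eq_square mult.assoc)
  qed
  ultimately show ?thesis
    by (simp add: is_inner_product_def)
qed

lemma sum_UNIV_option: "(\<Sum>i\<in>UNIV. f i) = f None + (\<Sum>i\<in>UNIV. f (Some i))"
  for f :: "'n::finite option \<Rightarrow> real"
  by (simp add: UNIV_option_conv sum.reindex)

text \<open>Mixed products vanish when no two distinct summands are nonzero. In this form the
  conditions on structure constants diagonalise the Ricci form.\<close>

lemma power2_sum_single:
  fixes a :: "'n::finite \<Rightarrow> real"
  assumes "\<And>k l. a k \<noteq> 0 \<Longrightarrow> a l \<noteq> 0 \<Longrightarrow> k = l"
  shows "(\<Sum>k\<in>UNIV. a k)\<^sup>2 = (\<Sum>k\<in>UNIV. (a k)\<^sup>2)"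
proof (cases "\<exists>k. a k \<noteq> 0")
  case True
  then obtain k where k: "a k \<noteq> 0"
    by blast
  have 0: "\<forall>l\<in>UNIV - {k}. a l = 0"
    using assms[OF k] by blast
  have "(\<Sum>l\<in>UNIV. a l) = a k" "(\<Sum>l\<in>UNIV. (a l)\<^sup>2) = (a k)\<^sup>2"
    using sum.mono_neutral_right[of UNIV "{k}" a] sum.mono_neutral_right[of UNIV "{k}" "\<lambda>l. (a l)\<^sup>2"] 0
    by auto
  then show ?thesis
    by simp
qed simp

lemma sum_weighted_swap:
  fixes w :: "'c \<Rightarrow> real"
  shows "(\<Sum>i\<in>I. \<Sum>j\<in>J. \<Sum>k\<in>K. w k * f i j k) = (\<Sum>k\<in>K. w k * (\<Sum>i\<in>I. \<Sum>j\<in>J. f i j k))"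
proof -
  have "(\<Sum>i\<in>I. \<Sum>j\<in>J. \<Sum>k\<in>K. w k * f i j k) = (\<Sum>i\<in>I. \<Sum>k\<in>K. \<Sum>j\<in>J. w k * f i j k)"
    by (intro sum.cong refl sum.swap)
  also have "\<dots> = (\<Sum>k\<in>K. \<Sum>i\<in>I. \<Sum>j\<in>J. w k * f i j k)"
    by (rule sum.swap)
  finally show ?thesis
    by (simp add: sum_distrib_left)
qed

text \<open>Each condition on the zero pattern of \<open>c\<close> removes one kind of cross term:
  \<open>target\<close> those in the squared components of \<open>[E i, E j]\<close> along
  \<open>x\<close>, \<open>source\<close> those in the squared entries of \<open>ad x\<close>, and
  \<open>acyclic\<close> those between an entry of \<open>ad x\<close> and its transpose.\<close>

lemma ricci_semidirect_diag:
  fixes br :: "'a::real_vector \<Rightarrow> 'a \<Rightarrow> 'a" and E :: "'n::finite \<Rightarrow> 'a"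
  defines "c \<equiv> struct_const br E"
  assumes L: "lie_algebra br" and D: "derivation br D" and E: "is_basis E" and h: "h > 0"
    and diag: "\<And>i. D (E i) = d i *\<^sub>R E i"
    and target: "\<And>i j k k'. c i j k \<noteq> 0 \<Longrightarrow> c i j k' \<noteq> 0 \<Longrightarrow> k = k'"
    and source: "\<And>i j l l'. c l i j \<noteq> 0 \<Longrightarrow> c l' i j \<noteq> 0 \<Longrightarrow> l = l'"
    and acyclic: "\<And>i j l l'. c l i j = 0 \<or> c l' j i = 0"
  shows "ricci (semidirect br D) (diag_metric h E) (s, x) (s, x) =
    (\<Sum>k\<in>UNIV. (coord E x k)\<^sup>2 *
       ((\<Sum>i\<in>UNIV. \<Sum>j\<in>UNIV. (c i j k)\<^sup>2) / 4 - (\<Sum>i\<in>UNIV. \<Sum>j\<in>UNIV. (c k i j)\<^sup>2) / 2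
        - (\<Sum>i\<in>UNIV. d i) * d k / h))
    - s\<^sup>2 * (\<Sum>i\<in>UNIV. (d i)\<^sup>2)"
proof -
  define g where "g = diag_metric h E"
  define S where "S = semidirect br D"
  define X where "X = coord E x"
  \<comment> \<open>\<open>b\<close> is the matrix of \<open>ad x\<close> on the ideal.
    \<open>Q\<close>, defined below, collects the brackets with the unit vector along
    \<open>f\<close>; it enters both double sums of the Ricci formula as \<open>2 * Q\<close> and
    cancels.\<close>
  define b where "b = (\<lambda>i j. \<Sum>l\<in>UNIV. X l * c l i j)"
  have b_eq: "(\<Sum>l\<in>UNIV. X l * c l i j) = b i j" for i j
    by (simp add: b_def)
  define B where "B = (\<Sum>i\<in>UNIV. \<Sum>j\<in>UNIV. (b i j)\<^sup>2)"
  define Q where "Q = (\<Sum>i\<in>UNIV. (d i * X i / sqrt h)\<^sup>2)"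
  have g: "is_inner_product g"
    unfolding g_def by (rule is_inner_product_diag_metric[OF E h])
  have LS: "lie_algebra S"
    unfolding S_def by (rule lie_algebra_semidirect[OF L D])
  have bbr: "bilinear br" and linD: "linear D"
    using L D by (auto simp: lie_algebra_def derivation_def)
  note lc = linear_add[OF linear_coord[OF E]] linear_scale[OF linear_coord[OF E]]
    linear_0[OF linear_coord[OF E]] linear_neg[OF linear_coord[OF E]]
    linear_sum[OF linear_coord[OF E]]
  note cb = coord_basis[OF E]
  note coordD = coord_diag_operator[OF E linD diag]
  have coord_br: "coord E (br v (E i)) j = (\<Sum>l\<in>UNIV. coord E v l * c l i j)" for v i j
  proof -
    have "linear (\<lambda>v. br v (E i))"
      using bbr by (simp add: bilinear_def)
    from linear_coord_expand[OF E this, of v] show ?thesis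
      by (simp add: lc c_def struct_const_coord)
  qed
  \<comment> \<open>An orthonormal basis of the semidirect sum: \<open>None\<close> is the index of
    the normalised \<open>f\<close>.\<close>
  define Z :: "'n option \<Rightarrow> real \<times> 'a" where
    "Z = (\<lambda>i. case i of None \<Rightarrow> (1 / sqrt h, 0) | Some i \<Rightarrow> (0, E i))"
  have Z[simp]: "Z None = (1 / sqrt h, 0)" "Z (Some i) = (0, E i)" for i
    by (simp_all add: Z_def)
  have orth: "g (Z i) (Z j) = (if i = j then 1 else 0)" for i j
    using h by (cases i; cases j)
      (simp_all add: g_def diag_metric_def lc cb mult_delta_left mult_delta_right)
  have "v \<in> span (range Z)" for v
  proof -
    have "(fst v, 0) = (fst v * sqrt h) *\<^sub>R Z None"
      using h by simp
    then have 1: "(fst v, 0) \<in> span (range Z)"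
      by (metis rangeI span_base span_scale)
    have "(0, snd v) = (\<Sum>i\<in>UNIV. coord E (snd v) i *\<^sub>R Z (Some i))"
      by (simp add: prod_eq_iff fst_sum snd_sum sum_coord[OF E])
    then have 2: "(0, snd v) \<in> span (range Z)"
      by (metis (no_types, lifting) rangeI span_base span_scale span_sum)
    have "v = (fst v, 0) + (0, snd v)"
      by simp
    then show ?thesis
      using span_add[OF 1 2] by simp
  qed
  then have span: "span (range Z) = UNIV"
    by auto
  have brZ: "g (S (Z None) (Z None)) (s, x) = 0"
    "g (S (Z None) (Z (Some i))) (s, x) = d i * X i / sqrt h"
    "g (S (Z (Some i)) (Z None)) (s, x) = - (d i * X i / sqrt h)"
    "g (S (Z (Some i)) (Z (Some j))) (s, x) = (\<Sum>k\<in>UNIV. c i j k * X k)" for i j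
    by (simp_all add: S_def g_def semidirect_def diag_metric_def lc cb X_def linear_0[OF linD] diag
        bilinear_lzero[OF bbr] bilinear_rzero[OF bbr] c_def struct_const_coord sum_negf mult_delta_left mult_delta_right)
  have ad: "g (S v (Z None)) (Z None) = 0"
    "g (S v (Z None)) (Z (Some i)) = - (d i * coord E (snd v) i / sqrt h)"
    "g (S v (Z (Some i))) (Z None) = 0"
    "g (S v (Z (Some i))) (Z (Some j)) =
       (if i = j then fst v * d i else 0) + (\<Sum>l\<in>UNIV. coord E (snd v) l * c l i j)" for v i j
    by (auto simp: S_def g_def semidirect_def diag_metric_def lc cb linear_0[OF linD] coordD
        bilinear_lzero[OF bbr] bilinear_rzero[OF bbr] coord_br mult_delta_left mult_delta_right)
  \<comment> \<open>Hence \<open>ad\<close> of an element of the ideal has zero diagonal, and the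
    trace in \<open>sum3\<close> sees only the multiple of \<open>D\<close>.\<close>
  have c0: "c l i i = 0" for l i
    using acyclic[of l i i l] by simp
  have "(\<Sum>k\<in>UNIV. c i j k * X k)\<^sup>2 = (\<Sum>k\<in>UNIV. (X k)\<^sup>2 * (c i j k)\<^sup>2)" for i j
    by (subst power2_sum_single) (use target in \<open>auto simp: power_mult_distrib mult.commute\<close>)
  then have sum1: "(\<Sum>i\<in>UNIV. \<Sum>j\<in>UNIV. (g (S (Z i) (Z j)) (s, x))\<^sup>2) =
      2 * Q + (\<Sum>k\<in>UNIV. (X k)\<^sup>2 * (\<Sum>i\<in>UNIV. \<Sum>j\<in>UNIV. (c i j k)\<^sup>2))"
    unfolding sum_UNIV_option brZ sum.distrib
    by (simp add: Q_def sum_weighted_swap)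
  have bsq: "(b i j)\<^sup>2 = (\<Sum>l\<in>UNIV. (X l)\<^sup>2 * (c l i j)\<^sup>2)" for i j
    unfolding b_def
    by (subst power2_sum_single) (use source in \<open>auto simp: power_mult_distrib\<close>)
  have B: "B = (\<Sum>k\<in>UNIV. (X k)\<^sup>2 * (\<Sum>i\<in>UNIV. \<Sum>j\<in>UNIV. (c k i j)\<^sup>2))"
    unfolding B_def bsq by (rule sum_weighted_swap)
  have B_swap: "(\<Sum>i\<in>UNIV. \<Sum>j\<in>UNIV. (b j i)\<^sup>2) = B"
    unfolding B_def by (rule sum.swap)
  have b_acyclic: "b i j = 0 \<or> b j i = 0" for i j
  proof (cases "\<exists>l. c l i j \<noteq> 0")
    case True
    then have "\<And>l. c l j i = 0"
      using acyclic by blast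
    then show ?thesis
      by (simp add: b_def)
  qed (simp add: b_def)
  \<comment> \<open>For \<open>i = j\<close>, \<open>b_acyclic\<close> gives
    \<open>b i i = 0\<close>, so the square is that of \<open>2 * s * d i\<close>; off the diagonal
    only the entries of \<open>b\<close> remain, and their product vanishes.\<close>
  have "((if i = j then s * d i else 0) + b i j + ((if j = i then s * d j else 0) + b j i))\<^sup>2
      = (if i = j then 4 * s\<^sup>2 * (d i)\<^sup>2 else 0) + (b i j)\<^sup>2 + (b j i)\<^sup>2" for i j
    using b_acyclic[of i j] by (auto simp: power2_eq_square algebra_simps)
  then have sum2: "(\<Sum>i\<in>UNIV. \<Sum>j\<in>UNIV. (g (S (s, x) (Z i)) (Z j) + g (S (s, x) (Z j)) (Z i))\<^sup>2) =
      2 * Q + 4 * s\<^sup>2 * (\<Sum>i\<in>UNIV. (d i)\<^sup>2) + 2 * B"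
    unfolding sum_UNIV_option ad fst_conv snd_conv X_def[symmetric] b_eq
    by (simp add: sum.distrib Q_def[symmetric] B_def[symmetric] B_swap sum_distrib_left[symmetric])
  \<comment> \<open>The trace of \<open>ad v\<close> is \<open>fst v\<close> times the trace of
    \<open>D\<close>, so only the component along \<open>f\<close> is required. Koszul tested
    against \<open>f\<close> reduces it to \<open>g (0, D x) (s, x)\<close>.\<close>
  have "fst (levi_civita S g (s, x) (s, x)) = (\<Sum>i\<in>UNIV. d i * (X i)\<^sup>2) / h"
  proof -
    have bg: "bilinear g"
      using g by (simp add: is_inner_product_def)
    have S: "S (s, x) (s, x) = 0" "S (s, x) (1, 0) = - (0, D x)" "S (1, 0) (s, x) = (0, D x)"
      using LS by (simp_all add: lie_algebra_def)
        (simp_all add: S_def semidirect_def bilinear_lzero[OF bbr] bilinear_rzero[OF bbr] linear_0[OF linD])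
    obtain A :: "(real \<times> 'a) set" where A: "finite A" "independent A" "span A = UNIV"
      using finite_spanning_basis[OF _ span] by auto
    have "2 * g (levi_civita S g (s, x) (s, x)) (1, 0) = 2 * g (0, D x) (s, x)"
      using koszul[OF g levi_civita[OF LS g A], of "(s, x)" "(s, x)" "(1, 0)"]
      by (simp only: S bilinear_lzero[OF bg] bilinear_lneg[OF bg])
    moreover have "g (0, D x) (s, x) = (\<Sum>i\<in>UNIV. d i * (X i)\<^sup>2)"
      by (simp add: g_def diag_metric_def coordD X_def power2_eq_square mult.assoc)
    moreover have "g v (1, 0) = h * fst v" for v
      by (simp add: g_def diag_metric_def lc)
    ultimately show ?thesis
      using h by (simp add: field_simps)
  qed
  then have sum3: "(\<Sum>i\<in>UNIV. g (S (levi_civita S g (s, x) (s, x)) (Z i)) (Z i)) =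
      (\<Sum>k\<in>UNIV. (X k)\<^sup>2 * ((\<Sum>i\<in>UNIV. d i) * d k / h))"
    unfolding sum_UNIV_option ad
    by (simp add: c0 sum_distrib_left[symmetric] sum_divide_distrib)
      (simp add: sum_distrib_right sum_distrib_left mult_ac)
  have "ricci S g (s, x) (s, x) =
      (2 * Q + (\<Sum>k\<in>UNIV. (X k)\<^sup>2 * (\<Sum>i\<in>UNIV. \<Sum>j\<in>UNIV. (c i j k)\<^sup>2))) / 4
      - (2 * Q + 4 * s\<^sup>2 * (\<Sum>i\<in>UNIV. (d i)\<^sup>2) + 2 * B) / 4
      - (\<Sum>k\<in>UNIV. (X k)\<^sup>2 * ((\<Sum>i\<in>UNIV. d i) * d k / h))"
    by (simp only: ricci_orthonormal[OF LS g orth span] sum1 sum2 sum3)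
  also have "\<dots> = (\<Sum>k\<in>UNIV. (X k)\<^sup>2 * (\<Sum>i\<in>UNIV. \<Sum>j\<in>UNIV. (c i j k)\<^sup>2)) / 4 - B / 2
      - (\<Sum>k\<in>UNIV. (X k)\<^sup>2 * ((\<Sum>i\<in>UNIV. d i) * d k / h)) - s\<^sup>2 * (\<Sum>i\<in>UNIV. (d i)\<^sup>2)"
    by (simp add: field_simps)
  also have "\<dots> = (\<Sum>k\<in>UNIV. (X k)\<^sup>2 *
       ((\<Sum>i\<in>UNIV. \<Sum>j\<in>UNIV. (c i j k)\<^sup>2) / 4 - (\<Sum>i\<in>UNIV. \<Sum>j\<in>UNIV. (c k i j)\<^sup>2) / 2
        - (\<Sum>i\<in>UNIV. d i) * d k / h)) - s\<^sup>2 * (\<Sum>i\<in>UNIV. (d i)\<^sup>2)"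
    unfolding B right_diff_distrib sum_subtractf
    by (simp only: sum_divide_distrib[where A = UNIV and f = "\<lambda>k. (X k)\<^sup>2 * _ k"] times_divide_eq_right)
  finally show ?thesis
    unfolding S_def g_def X_def .
qed

section \<open>Exponential sums whose gradients approximate a prescribed point of a cone\<close>

section \<open>Choosing the metric\<close>

lemma exp_minus_linear_bounded_below:
  fixes c m :: real
  assumes "c > 0" "m \<ge> 0"
  shows "\<exists>b. \<forall>t. b \<le> c * exp t - m * t"
proof (cases "m = 0")
  case True
  then show ?thesis
    using assms by (intro exI[of _ 0]) simp
next
  case False
  then have m: "m > 0"
    using assms by simp
  \<comment> \<open>The bound is the minimum, attained at \<open>exp t = m / c\<close>. It follows
    from \<open>1 + u \<le> exp u\<close> at \<open>u = t + ln (c / m)\<close>.\<close>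
  have "m * (1 + ln (c / m)) \<le> c * exp t - m * t" for t
  proof -
    have "m * (1 + (t + ln (c / m))) \<le> m * exp (t + ln (c / m))"
      using m by (intro mult_left_mono exp_ge_add_one_self) auto
    also have "\<dots> = c * exp t"
      using m assms by (simp add: exp_add)
    finally show ?thesis
      by (simp add: algebra_simps)
  qed
  then show ?thesis
    by blast
qed

text \<open>Only approximation can be expected, since weights \<open>m s\<close> may be zero: if all
  vanish and the exponents lie in an open half-space, a nonempty exponential sum never reaches the
  target.\<close>

lemma exponential_sum_approximates_cone:
  fixes \<alpha> :: "'s \<Rightarrow> 'v::euclidean_space"
  assumes fin: "finite I" and c: "\<And>s. s \<in> I \<Longrightarrow> c s > 0" and m: "\<And>s. s \<in> I \<Longrightarrow> m s \<ge> 0"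
    and eps: "\<epsilon> > 0"
  shows "\<exists>x. norm ((\<Sum>s\<in>I. (c s * exp (\<alpha> s \<bullet> x)) *\<^sub>R \<alpha> s) - (\<Sum>s\<in>I. m s *\<^sub>R \<alpha> s)) < \<epsilon>"
proof -
  \<comment> \<open>Minimise the exponential sum minus its linear part, plus a small multiple \<open>\<delta>\<close> of \<open>\<parallel>x\<parallel>\<^sup>2\<close>: at the
    minimum the difference is \<open>- 2 \<delta> x\<close>, while \<open>\<delta> \<parallel>x\<parallel>\<^sup>2\<close> is bounded independently of \<open>\<delta>\<close>.\<close>
  have "\<forall>s\<in>I. \<exists>b. \<forall>t. b \<le> c s * exp t - m s * t"
    using exp_minus_linear_bounded_below c m by blast
  then obtain b where b: "\<And>s t. s \<in> I \<Longrightarrow> b s \<le> c s * exp t - m s * t"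
    by metis
  \<comment> \<open>\<open>K\<close> is the gap between the value of \<open>\<phi>\<close> at the
    origin and a lower bound for its part without \<open>\<delta>\<close>.\<close>
  define K where "K = (\<Sum>s\<in>I. c s) - (\<Sum>s\<in>I. b s)"
  have K: "K \<ge> 0"
    using b[of _ 0] by (auto simp: K_def intro: sum_mono)
  \<comment> \<open>The square of the error will be at most \<open>4 * \<delta> * K\<close>, which
    this choice makes \<open>K / (K + 1)\<close> times the square of \<open>\<epsilon>\<close>. The
    summand 4 keeps the denominator positive when \<open>K = 0\<close>.\<close>
  define \<delta> where "\<delta> = \<epsilon>\<^sup>2 / (4 * K + 4)"
  have \<delta>: "\<delta> > 0" "4 * \<delta> * K < \<epsilon>\<^sup>2"
    using eps K by (auto simp: \<delta>_def field_simps)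
  define \<phi> where "\<phi> = (\<lambda>x. (\<Sum>s\<in>I. c s * exp (\<alpha> s \<bullet> x) - m s * (\<alpha> s \<bullet> x)) + \<delta> * (x \<bullet> x))"
  have \<phi>0: "\<phi> 0 = (\<Sum>s\<in>I. c s)"
    by (simp add: \<phi>_def)
  have lower: "(\<Sum>s\<in>I. b s) + \<delta> * (norm x)\<^sup>2 \<le> \<phi> x" for x
    unfolding \<phi>_def power2_norm_eq_inner by (intro add_mono sum_mono b order_refl)
  have sublevel: "\<delta> * (norm x)\<^sup>2 \<le> K" if "\<phi> x \<le> \<phi> 0" for x
    using lower[of x] that by (simp add: \<phi>0 K_def)
  \<comment> \<open>Outside the ball of radius \<open>R\<close> the value of \<open>\<phi>\<close>
    exceeds \<open>\<phi> 0\<close>, so a minimum over the compact ball is a global one.\<close>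
  define R where "R = sqrt (K / \<delta>)"
  have "R \<ge> 0"
    using K \<delta> by (simp add: R_def)
  have inball: "norm x \<le> R" if "\<phi> x \<le> \<phi> 0" for x
    unfolding R_def using sublevel[OF that] \<delta> by (intro real_le_rsqrt) (simp add: field_simps)
  have "continuous_on (cball 0 R) \<phi>"
    unfolding \<phi>_def by (intro continuous_intros)
  then obtain x where x: "x \<in> cball 0 R" "\<And>y. y \<in> cball 0 R \<Longrightarrow> \<phi> x \<le> \<phi> y"
    using continuous_attains_inf[of "cball 0 R" \<phi>] \<open>R \<ge> 0\<close> by auto
  have min: "\<phi> x \<le> \<phi> y" for y
  proof (cases "norm y \<le> R")
    case False
    then have "\<phi> 0 < \<phi> y"
      using inball[of y] by linarith
    then show ?thesis
      using x(2)[of 0] \<open>R \<ge> 0\<close> by simp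
  qed (simp add: x)
  \<comment> \<open>\<open>G\<close> is the gradient of \<open>\<phi>\<close> at the minimiser. The
    derivative in the direction \<open>G\<close> itself is \<open>G \<bullet> G\<close>, so one
    directional derivative shows that the gradient is zero.\<close>
  define G where "G = (\<Sum>s\<in>I. (c s * exp (\<alpha> s \<bullet> x) - m s) *\<^sub>R \<alpha> s) + (2 * \<delta>) *\<^sub>R x"
  have "((\<lambda>t. \<phi> (x + t *\<^sub>R G)) has_real_derivative
      (\<Sum>s\<in>I. c s * (exp (\<alpha> s \<bullet> x) * (\<alpha> s \<bullet> G)) - m s * (\<alpha> s \<bullet> G)) + \<delta> * (2 * (x \<bullet> G))) (at 0)"
    unfolding \<phi>_def inner_add inner_scaleR_left inner_scaleR_right
    by (rule derivative_eq_intros refl | simp)+ (simp add: inner_commute mult_ac)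
  moreover have "(\<Sum>s\<in>I. c s * (exp (\<alpha> s \<bullet> x) * (\<alpha> s \<bullet> G)) - m s * (\<alpha> s \<bullet> G)) + \<delta> * (2 * (x \<bullet> G)) = G \<bullet> G"
    by (subst (3) G_def) (simp add: inner_sum_left inner_add_left algebra_simps)
  ultimately have "((\<lambda>t. \<phi> (x + t *\<^sub>R G)) has_real_derivative G \<bullet> G) (at 0)"
    by simp
  then have "G \<bullet> G = 0"
    by (rule DERIV_local_min[of _ _ _ 1]) (use min in auto)
  then have "(\<Sum>s\<in>I. (c s * exp (\<alpha> s \<bullet> x)) *\<^sub>R \<alpha> s) - (\<Sum>s\<in>I. m s *\<^sub>R \<alpha> s) = - ((2 * \<delta>) *\<^sub>R x)"
    by (simp add: G_def sum_subtractf scaleR_diff_left eq_neg_iff_add_eq_0)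
  then have "norm ((\<Sum>s\<in>I. (c s * exp (\<alpha> s \<bullet> x)) *\<^sub>R \<alpha> s) - (\<Sum>s\<in>I. m s *\<^sub>R \<alpha> s)) = 2 * \<delta> * norm x"
    using \<delta> by simp
  moreover have "(2 * \<delta> * norm x)\<^sup>2 < \<epsilon>\<^sup>2"
  proof -
    have "(2 * \<delta> * norm x)\<^sup>2 = 4 * \<delta> * (\<delta> * (norm x)\<^sup>2)"
      by (simp add: power2_eq_square)
    also have "\<dots> \<le> 4 * \<delta> * K"
      using sublevel[OF min] \<delta> by (intro mult_left_mono) auto
    finally show ?thesis
      using \<delta> by linarith
  qed
  then have "2 * \<delta> * norm x < \<epsilon>"
    by (rule power2_less_imp_less) (use eps in simp)
  ultimately show ?thesis
    by (intro exI[of _ x]) simp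
qed

section \<open>Zero pattern of the structure constants in a nice basis, and their rescaling\<close>

section \<open>Nice bases\<close>

lemma nice_basis_bracket:
  assumes nice: "nice_basis br e" and c: "struct_const br e i j k \<noteq> 0"
  shows "br (e i) (e j) = struct_const br e i j k *\<^sub>R e k"
proof -
  have e: "is_basis e"
    using nice by (simp add: nice_basis_def)
  obtain l a where a: "br (e i) (e j) = a *\<^sub>R e l"
    using nice[unfolded nice_basis_def, THEN conjunct2, THEN conjunct1] by meson
  then have "struct_const br e i j k = (if k = l then a else 0)"
    by (simp add: struct_const_coord linear_scale[OF linear_coord[OF e]] coord_basis[OF e])
  with a c show ?thesis
    by (auto split: if_splits)
qed

lemma nice_basis_target:
  assumes nice: "nice_basis br e"
    and c: "struct_const br e i j k \<noteq> 0" "struct_const br e i j k' \<noteq> 0"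
  shows "k = k'"
proof (rule ccontr)
  assume "k \<noteq> k'"
  moreover have e: "is_basis e"
    using nice by (simp add: nice_basis_def)
  ultimately have "coord e (br (e i) (e j)) k' = 0"
    by (simp add: nice_basis_bracket[OF nice c(1)] linear_scale[OF linear_coord[OF e]]
        coord_basis[OF e])
  with c(2) show False
    by (simp add: struct_const_coord)
qed

text \<open>Both brackets are nonzero multiples of \<open>e j\<close>, and their index pairs share
  \<open>i\<close>. They cannot be disjoint, so niceness forces them to be equal.\<close>

lemma nice_basis_source:
  assumes L: "lie_algebra br" and nice: "nice_basis br e"
    and c: "struct_const br e l i j \<noteq> 0" "struct_const br e l' i j \<noteq> 0"
  shows "l = l'"
proof -
  have "{l, i} = {l', i} \<or> {l, i} \<inter> {l', i} = {}"
    using nice_basis_bracket[OF nice c(1)] nice_basis_bracket[OF nice c(2)] c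
    by (intro nice[unfolded nice_basis_def, THEN conjunct2, THEN conjunct2, rule_format, of l i j l' i]) blast
  moreover have "l \<noteq> i"
  proof -
    have "is_basis e" "br (e i) (e i) = 0"
      using nice L by (simp_all add: nice_basis_def lie_algebra_def)
    then show ?thesis
      using c(1) by (auto simp: struct_const_coord linear_0[OF linear_coord])
  qed
  ultimately show ?thesis
    by (auto simp: doubleton_eq_iff)
qed

lemma nice_basis_acyclic:
  assumes nil: "nilpotent_lie br" and nice: "nice_basis br e"
  shows "struct_const br e l i j = 0 \<or> struct_const br e l' j i = 0"
proof (rule ccontr)
  assume "\<not> ?thesis"
  then have c: "struct_const br e l i j \<noteq> 0" "struct_const br e l' j i \<noteq> 0"
    by auto
  \<comment> \<open>Otherwise \<open>e i\<close> and \<open>e j\<close> reproduce each other up to scaling and never leave the lower central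
    series.\<close>
  have step: "e k' \<in> lower_central br (Suc m)"
    if "struct_const br e r k k' \<noteq> 0" "e k \<in> lower_central br m" for r k k' m
  proof -
    have eq: "e k' = (1 / struct_const br e r k k') *\<^sub>R br (e r) (e k)"
      using nice_basis_bracket[OF nice that(1)] that(1) by simp
    have "br (e r) (e k) \<in> lower_central br (Suc m)"
      using that(2) by (auto intro: span_base)
    then show ?thesis
      unfolding eq lower_central.simps by (rule span_scale)
  qed
  have "e i \<in> lower_central br m \<and> e j \<in> lower_central br m" for m
    using step c by (induction m) auto
  moreover have "e i \<noteq> 0"
    using nice dependent_zero[of "range e"] by (metis is_basis_def nice_basis_def rangeI)
  ultimately show False
    using nil by (metis nilpotent_lie_def singletonD)
qed

lemma rescaled_basis:
  assumes e: "is_basis e" and b: "\<And>i. b i \<noteq> 0"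
  shows "is_basis (\<lambda>i. b i *\<^sub>R e i)" and "coord (\<lambda>i. b i *\<^sub>R e i) v i = coord e v i / b i"
proof -
  have "e i \<in> span (range (\<lambda>i. b i *\<^sub>R e i))" for i
  proof -
    have "(1 / b i) *\<^sub>R b i *\<^sub>R e i \<in> span (range (\<lambda>i. b i *\<^sub>R e i))"
      by (intro span_scale span_base rangeI)
    then show ?thesis
      using b by simp
  qed
  then have "span (range e) \<subseteq> span (range (\<lambda>i. b i *\<^sub>R e i))"
    by (intro span_minimal) auto
  then have span: "span (range (\<lambda>i. b i *\<^sub>R e i)) = UNIV"
    using e by (auto simp: is_basis_def)
  have lin: "linear (\<lambda>v. coord e v i / b i)" for i
    using linear_compose_scale_right[OF linear_coord[OF e], of "1 / b i"] by simp
  have dual: "coord e (b j *\<^sub>R e j) i / b i = (if i = j then 1 else 0)" for i j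
    using b by (simp add: linear_scale[OF linear_coord[OF e]] coord_basis[OF e])
  show "is_basis (\<lambda>i. b i *\<^sub>R e i)" "coord (\<lambda>i. b i *\<^sub>R e i) v i = coord e v i / b i"
    using is_basis_dual[of "\<lambda>v i. coord e v i / b i" "\<lambda>i. b i *\<^sub>R e i", OF lin dual span] by auto
qed

lemma struct_const_rescaled:
  assumes L: "lie_algebra br" and e: "is_basis e" and b: "\<And>i. b i \<noteq> 0"
  shows "struct_const br (\<lambda>i. b i *\<^sub>R e i) i j k = b i * b j / b k * struct_const br e i j k"
proof -
  have "bilinear br"
    using L by (simp add: lie_algebra_def)
  then show ?thesis
    by (simp add: struct_const_coord rescaled_basis(2)[OF e b] bilinear_lmul bilinear_rmul
        linear_scale[OF linear_coord[OF e]])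
qed


section \<open>The linear space of diagonal derivations\<close>

section \<open>Diagonal derivations\<close>

lemma op_of_matrix_linear_comb:
  "op_of_matrix e (u *\<^sub>R A + v *\<^sub>R B) x = u *\<^sub>R op_of_matrix e A x + v *\<^sub>R op_of_matrix e B x"
  by (simp add: op_of_matrix_def algebra_simps sum.distrib scaleR_sum_right)

lemma op_of_matrix_diag:
  assumes e: "is_basis e" and A: "A \<in> diag_matrices"
  shows "op_of_matrix e A (e j) = A $ j $ j *\<^sub>R e j"
proof -
  have "op_of_matrix e A (e j) = (\<Sum>i\<in>UNIV. A $ i $ j *\<^sub>R e i)"
    unfolding op_of_matrix_def coord_def[symmetric] coord_basis[OF e]
    by (simp add: mult_delta_right if_distrib[of "\<lambda>r. r *\<^sub>R _"] cong: if_cong)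
  also have "\<dots> = (\<Sum>i\<in>UNIV. if i = j then A $ j $ j *\<^sub>R e j else 0)"
    using A by (intro sum.cong) (auto simp: diag_matrices_def)
  finally show ?thesis
    by simp
qed

lemma subspace_diag_matrices: "subspace diag_matrices"
  by (auto simp: subspace_def diag_matrices_def)

text \<open>The Leibniz rule is linear in the operator. This supplies convexity and closure under
  scaling for the derivation part of the final cone.\<close>

lemma subspace_diag_derivations:
  assumes "lie_algebra br"
  shows "subspace (diag_derivations br e)"
proof -
  have bil: "bilinear br"
    using assms by (simp add: lie_algebra_def)
  note simps = bilinear_ladd[OF bil] bilinear_radd[OF bil] bilinear_lmul[OF bil]
    bilinear_rmul[OF bil] bilinear_lzero[OF bil] bilinear_rzero[OF bil]
  have comb: "u *\<^sub>R A + v *\<^sub>R B \<in> diag_derivations br e"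
    if "A \<in> diag_derivations br e" "B \<in> diag_derivations br e" for u v A B
  proof -
    have "derivation br (\<lambda>x. u *\<^sub>R op_of_matrix e A x + v *\<^sub>R op_of_matrix e B x)"
      using that unfolding diag_derivations_def derivation_def
      by (auto simp: simps algebra_simps intro!: linear_compose_add linear_compose_scale_right)
    then show ?thesis
      using that
      by (simp add: diag_derivations_def op_of_matrix_linear_comb[abs_def]
          subspace_add[OF subspace_diag_matrices] subspace_scale[OF subspace_diag_matrices])
  qed
  have "derivation br (op_of_matrix e 0)"
    by (simp add: derivation_def op_of_matrix_def[abs_def] simps linear_zero)
  then have "0 \<in> diag_derivations br e"
    by (simp add: diag_derivations_def subspace_0[OF subspace_diag_matrices])
  then show ?thesis
    using comb[of _ _ 1 1] comb[of _ _ _ 0] by (force simp: subspace_def)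
qed

section \<open>The hull \<open>CH\<close> and the open cone built from it\<close>

lemma F_matrix_diag: "F_matrix i j k $ l $ l =
    (if l = k then 1 else 0) - (if l = i then 1 else 0) - (if l = j then 1 else 0)"
  by (simp add: F_matrix_def matrix_unit_def)

lemma CH_subset_diag_matrices: "CH br e \<subseteq> diag_matrices"
  unfolding CH_def
  by (intro hull_minimal subspace_imp_convex subspace_diag_matrices)
    (auto simp: diag_matrices_def F_matrix_def matrix_unit_def)

text \<open>The cone of nonnegative combinations is convex and contains the generators, hence the
  hull. Summing over all triples instead of those with \<open>i < j\<close> matches the unrestricted
  double sums of the Ricci form.\<close>

lemma CH_subset_cone:
  fixes e :: "'n::{finite,linorder} \<Rightarrow> 'a::real_vector"
  assumes "a \<in> CH br e"
  obtains m where "\<And>s. m s \<ge> 0"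
    and "a = (\<Sum>(i, j, k)\<in>{(i, j, k). struct_const br e i j k \<noteq> 0}. m (i, j, k) *\<^sub>R F_matrix i j k)"
proof -
  define I where "I = {(i, j, k). struct_const br e i j k \<noteq> 0}"
  define F :: "'n \<times> 'n \<times> 'n \<Rightarrow> _" where "F = (\<lambda>(i, j, k). F_matrix i j k)"
  define K where "K = {\<Sum>s\<in>I. m s *\<^sub>R F s | m. \<forall>s. m s \<ge> (0::real)}"
  have "F s \<in> K" if "s \<in> I" for s
  proof -
    have "F s = (\<Sum>t\<in>I. (if t = s then 1 else 0) *\<^sub>R F t)"
      using that by (simp add: if_distrib[of "\<lambda>r. r *\<^sub>R _"] cong: if_cong)
    then show ?thesis
      unfolding K_def by (intro CollectI exI[of _ "\<lambda>t. if t = s then 1 else 0"]) simp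
  qed
  then have "{F_matrix i j k | i j k. i < j \<and> struct_const br e i j k \<noteq> 0} \<subseteq> K"
    by (fastforce simp: F_def I_def)
  moreover have "convex K"
  proof (rule convexI)
    fix x y u v
    assume xy: "x \<in> K" "y \<in> K" and uv: "0 \<le> u" "0 \<le> v" "u + v = (1::real)"
    then obtain m m' where "x = (\<Sum>s\<in>I. m s *\<^sub>R F s)" "y = (\<Sum>s\<in>I. m' s *\<^sub>R F s)"
      "\<forall>s. m s \<ge> 0" "\<forall>s. m' s \<ge> 0"
      by (auto simp: K_def)
    then show "u *\<^sub>R x + v *\<^sub>R y \<in> K"
      unfolding K_def using uv
      by (intro CollectI exI[of _ "\<lambda>s. u * m s + v * m' s"])
        (simp add: scaleR_sum_right scaleR_add_left sum.distrib)
  qed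
  ultimately have "CH br e \<subseteq> K"
    unfolding CH_def by (rule hull_minimal)
  then obtain m where m: "a = (\<Sum>s\<in>I. m s *\<^sub>R F s)" "\<forall>s. m s \<ge> 0"
    using assms unfolding K_def by blast
  show ?thesis
  proof
    show "m s \<ge> 0" for s
      using m(2) by blast
  qed (simp add: m(1) I_def F_def case_prod_unfold)
qed

lemma convex_pos_ray_plus:
  assumes A: "convex A" and B: "convex B"
  shows "convex (pos_ray_plus A B)"
proof (rule convexI)
  fix x y u v
  assume "x \<in> pos_ray_plus A B" "y \<in> pos_ray_plus A B" and uv: "0 \<le> u" "0 \<le> v" "u + v = (1::real)"
  then obtain r a b r' a' b' where x: "x = r *\<^sub>R a + b" "r > 0" "a \<in> A" "b \<in> B"
    and y: "y = r' *\<^sub>R a' + b'" "r' > 0" "a' \<in> A" "b' \<in> B"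
    by (auto simp: pos_ray_plus_def)
  \<comment> \<open>The common ray factor of the combination. Dividing by it turns
    \<open>u * r\<close> and \<open>v * r'\<close> into convex weights; it is positive because
    \<open>r\<close> and \<open>r'\<close> are and \<open>u\<close>, \<open>v\<close> do not both
    vanish.\<close>
  define R where "R = u * r + v * r'"
  have R: "R > 0"
  proof (cases "u > 0")
    case True
    then show ?thesis
      using uv x(2) y(2) by (simp add: R_def add_pos_nonneg)
  next
    case False
    then show ?thesis
      using uv y(2) by (simp add: R_def)
  qed
  have "(u * r / R) *\<^sub>R a + (v * r' / R) *\<^sub>R a' \<in> A"
    using x y uv R by (intro convexD[OF A]) (auto simp: R_def add_divide_distrib[symmetric])
  moreover have "u *\<^sub>R b + v *\<^sub>R b' \<in> B"
    using x y uv by (intro convexD[OF B])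
  moreover have "u *\<^sub>R x + v *\<^sub>R y =
      R *\<^sub>R ((u * r / R) *\<^sub>R a + (v * r' / R) *\<^sub>R a') + (u *\<^sub>R b + v *\<^sub>R b')"
    using R by (simp add: x y algebra_simps)
  ultimately show "u *\<^sub>R x + v *\<^sub>R y \<in> pos_ray_plus A B"
    unfolding pos_ray_plus_def using R by blast
qed

lemma pos_cone_pos_ray_plus:
  assumes "pos_cone B"
  shows "pos_cone (pos_ray_plus A B)"
  unfolding pos_cone_def
proof (intro ballI allI impI)
  fix x and t :: real
  assume "x \<in> pos_ray_plus A B" and t: "t > 0"
  then obtain r a b where x: "x = r *\<^sub>R a + b" "r > 0" "a \<in> A" "b \<in> B"
    by (auto simp: pos_ray_plus_def)
  have "t *\<^sub>R x = (t * r) *\<^sub>R a + t *\<^sub>R b" "t * r > 0" "t *\<^sub>R b \<in> B"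
    using x t assms by (auto simp: scaleR_add_right pos_cone_def)
  then show "t *\<^sub>R x \<in> pos_ray_plus A B"
    unfolding pos_ray_plus_def using x(3) by blast
qed

text \<open>The positive summand can be recovered as \<open>A - r *\<^sub>R a\<close>. For fixed
  \<open>r\<close> and \<open>a\<close>, membership becomes finitely many strict inequalities, which
  yield both the openness of the cone and the slack for the choice of metric.\<close>

lemma mem_pos_ray_plus_diag:
  assumes A: "A \<in> diag_matrices" and H: "H \<subseteq> diag_matrices"
  shows "A \<in> pos_ray_plus H pos_diag_matrices \<longleftrightarrow>
    (\<exists>r>0. \<exists>a\<in>H. \<forall>i. r * a $ i $ i < A $ i $ i)"
proof
  assume "A \<in> pos_ray_plus H pos_diag_matrices"
  then obtain r a b where "A = r *\<^sub>R a + b" "r > 0" "a \<in> H" "b \<in> pos_diag_matrices"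
    unfolding pos_ray_plus_def by blast
  then show "\<exists>r>0. \<exists>a\<in>H. \<forall>i. r * a $ i $ i < A $ i $ i"
    by (intro exI[of _ r] bexI[of _ a] conjI allI) (simp_all add: pos_diag_matrices_def)
next
  assume "\<exists>r>0. \<exists>a\<in>H. \<forall>i. r * a $ i $ i < A $ i $ i"
  then obtain r a where ra: "r > 0" "a \<in> H" "\<forall>i. r * a $ i $ i < A $ i $ i"
    by blast
  then have "A - r *\<^sub>R a \<in> pos_diag_matrices"
    using A H
    by (auto simp: pos_diag_matrices_def intro!: subspace_diff[OF subspace_diag_matrices]
        subspace_scale[OF subspace_diag_matrices])
  moreover have "A = r *\<^sub>R a + (A - r *\<^sub>R a)"
    by simp
  ultimately show "A \<in> pos_ray_plus H pos_diag_matrices"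
    unfolding pos_ray_plus_def using ra by blast
qed

section \<open>Construction of a metric with negative Ricci curvature\<close>

lemma pos_ray_plus_subset_ricci_negative:
  fixes br :: "'a::real_vector \<Rightarrow> 'a \<Rightarrow> 'a" and e :: "'n::{finite,linorder} \<Rightarrow> 'a"
  assumes L: "lie_algebra br" and nil: "nilpotent_lie br" and nice: "nice_basis br e"
    and A: "A \<in> pos_ray_plus (CH br e) pos_diag_matrices" "A \<in> diag_derivations br e"
    and tr: "trace A > 0"
  shows "A \<in> diag_ricci_negative br e"
proof -
  define c where "c = struct_const br e"
  define d where "d = (\<lambda>i. A $ i $ i)"
  define D where "D = op_of_matrix e A"
  \<comment> \<open>\<open>I\<close> runs over all ordered pairs \<open>(i, j)\<close>, whence the factor \<open>1 / 2\<close> in the weights below.\<close>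
  define I where "I = {(i, j, k). c i j k \<noteq> 0}"
  \<comment> \<open>The diagonals of the \<open>F_matrix\<close> are read as vectors, so that the
    approximation lemma applies with the Euclidean inner product.\<close>
  define \<alpha> :: "'n \<times> 'n \<times> 'n \<Rightarrow> (real, 'n) vec" where "\<alpha> = (\<lambda>(i, j, k). \<chi> l. F_matrix i j k $ l $ l)"
  have e: "is_basis e"
    using nice by (simp add: nice_basis_def)
  have diagA: "A \<in> diag_matrices" and der: "derivation br D"
    using A(2) by (auto simp: diag_derivations_def D_def)
  obtain r a where ra: "r > 0" "a \<in> CH br e" "\<And>i. r * a $ i $ i < d i"
    using A(1) mem_pos_ray_plus_diag[OF diagA CH_subset_diag_matrices] unfolding d_def by blast
  obtain m where m: "\<And>s. m s \<ge> 0"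
    "a = (\<Sum>(i, j, k)\<in>{(i, j, k). struct_const br e i j k \<noteq> 0}. m (i, j, k) *\<^sub>R F_matrix i j k)"
    using CH_subset_cone[OF ra(2)] by blast
  have a: "a $ l $ l = (\<Sum>s\<in>I. m s * \<alpha> s $ l)" for l
    by (simp add: m(2) I_def c_def \<alpha>_def case_prod_unfold)
  \<comment> \<open>The least slack over the finitely many diagonal entries: an error of norm below
    it preserves every strict inequality.\<close>
  define \<epsilon> where "\<epsilon> = Min (range (\<lambda>i. d i - r * a $ i $ i))"
  have "\<epsilon> > 0"
    unfolding \<epsilon>_def using ra(3) by (subst Min_gr_iff) auto
  have \<epsilon>: "\<epsilon> \<le> d i - r * a $ i $ i" for i
    unfolding \<epsilon>_def by (rule Min_le) auto
  obtain x where x: "norm ((\<Sum>s\<in>I. ((\<lambda>(i, j, k). (c i j k)\<^sup>2 / 2) s * exp (\<alpha> s \<bullet> x)) *\<^sub>R \<alpha> s)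
      - (\<Sum>s\<in>I. (r * m s) *\<^sub>R \<alpha> s)) < \<epsilon>"
    using exponential_sum_approximates_cone[of I "\<lambda>(i, j, k). (c i j k)\<^sup>2 / 2" "\<lambda>s. r * m s" \<epsilon> \<alpha>]
      \<open>\<epsilon> > 0\<close> ra(1) m(1) by (auto simp: I_def)
  define b where "b = (\<lambda>i. exp (- x $ i / 2))"
  define E where "E = (\<lambda>i. b i *\<^sub>R e i)"
  define C where "C = struct_const br E"
  have b: "b i \<noteq> 0" for i
    by (simp add: b_def)
  have E: "is_basis E"
    unfolding E_def by (rule rescaled_basis(1)[OF e b])
  have C: "C i j k = b i * b j / b k * c i j k" for i j k
    unfolding C_def E_def c_def by (rule struct_const_rescaled[OF L e b])
  have C0: "C i j k \<noteq> 0 \<longleftrightarrow> c i j k \<noteq> 0" for i j k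
    using b by (simp add: C)
  have "\<alpha> (i, j, k) \<bullet> x = x $ k - x $ i - x $ j" for i j k
    by (simp add: \<alpha>_def inner_vec_def F_matrix_diag left_diff_distrib sum_subtractf mult_delta_left)
  then have C2: "(C i j k)\<^sup>2 = (c i j k)\<^sup>2 * exp (\<alpha> (i, j, k) \<bullet> x)" for i j k
    by (simp add: C b_def power_mult_distrib power_divide exp_double[symmetric] exp_add[symmetric]
        exp_diff[symmetric] algebra_simps)
  have C_skew: "(C i j k)\<^sup>2 = (C j i k)\<^sup>2" for i j k
    using lie_skew[OF L, of "E i" "E j"]
    by (simp add: C_def struct_const_coord linear_neg[OF linear_coord[OF E]])
  \<comment> \<open>Twice the left side is the \<open>l\<close>-th component of the exponential sum.
    The entry \<open>+1\<close> of \<open>F_matrix\<close> gives the first double sum; the two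
    entries \<open>-1\<close> give equal contributions by \<open>C_skew\<close> and together form
    the second.\<close>
  have coeff: "(\<Sum>i\<in>UNIV. \<Sum>j\<in>UNIV. (C i j l)\<^sup>2) / 4 - (\<Sum>i\<in>UNIV. \<Sum>j\<in>UNIV. (C l i j)\<^sup>2) / 2 < d l / 2" for l
  proof -
    have "(\<Sum>s\<in>I. (\<lambda>(i, j, k). (C i j k)\<^sup>2 / 2) s * \<alpha> s $ l) - (\<Sum>s\<in>I. r * m s * \<alpha> s $ l) < \<epsilon>"
    proof -
      let ?v = "(\<Sum>s\<in>I. ((\<lambda>(i, j, k). (c i j k)\<^sup>2 / 2) s * exp (\<alpha> s \<bullet> x)) *\<^sub>R \<alpha> s)
        - (\<Sum>s\<in>I. (r * m s) *\<^sub>R \<alpha> s)"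
      have "?v $ l < \<epsilon>"
        using x component_le_norm_cart[of ?v l] by linarith
      then show ?thesis
        by (simp add: C2 case_prod_unfold mult_ac)
    qed
    moreover have "(\<Sum>s\<in>I. r * m s * \<alpha> s $ l) = r * a $ l $ l"
      by (simp add: a sum_distrib_left mult.assoc)
    ultimately have "(\<Sum>s\<in>I. (\<lambda>(i, j, k). (C i j k)\<^sup>2 / 2) s * \<alpha> s $ l) < d l"
      using \<epsilon>[of l] by linarith
    also have "(\<Sum>s\<in>I. (\<lambda>(i, j, k). (C i j k)\<^sup>2 / 2) s * \<alpha> s $ l)
        = (\<Sum>s\<in>UNIV. (\<lambda>(i, j, k). (C i j k)\<^sup>2 / 2) s * \<alpha> s $ l)"
      using C0 by (intro sum.mono_neutral_left) (auto simp: I_def)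
    also have "\<dots> = (\<Sum>i\<in>UNIV. \<Sum>j\<in>UNIV. \<Sum>k\<in>UNIV. (C i j k)\<^sup>2 / 2 * \<alpha> (i, j, k) $ l)"
      unfolding UNIV_Times_UNIV[symmetric] by (simp add: sum.cartesian_product case_prod_unfold)
    also have "\<dots> = (\<Sum>i\<in>UNIV. \<Sum>j\<in>UNIV. (C i j l)\<^sup>2 / 2)
        - (\<Sum>j\<in>UNIV. \<Sum>k\<in>UNIV. (C l j k)\<^sup>2 / 2) - (\<Sum>i\<in>UNIV. \<Sum>k\<in>UNIV. (C i l k)\<^sup>2 / 2)"
    proof -
      have sum_if: "(\<Sum>k\<in>UNIV. if P then f k else 0) = (if P then \<Sum>k\<in>UNIV. f k else 0)"
        for P and f :: "'n \<Rightarrow> real"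
        by simp
      have *: "(C i j k)\<^sup>2 / 2 * \<alpha> (i, j, k) $ l = (if l = k then (C i j l)\<^sup>2 / 2 else 0)
          - (if l = i then (C l j k)\<^sup>2 / 2 else 0) - (if l = j then (C i l k)\<^sup>2 / 2 else 0)" for i j k
        by (simp add: \<alpha>_def F_matrix_diag)
      show ?thesis
        unfolding * by (simp add: sum_subtractf sum_if)
    qed
    also have "(\<Sum>i\<in>UNIV. \<Sum>k\<in>UNIV. (C i l k)\<^sup>2 / 2) = (\<Sum>j\<in>UNIV. \<Sum>k\<in>UNIV. (C l j k)\<^sup>2 / 2)"
      by (simp add: C_skew[of _ l])
    finally show ?thesis
      by (simp add: sum_divide_distrib[symmetric])
  qed
  have trd: "trace A = (\<Sum>i\<in>UNIV. d i)"
    by (simp add: trace_def d_def)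
  have DE: "D (E i) = d i *\<^sub>R E i" for i
    using der op_of_matrix_diag[OF e diagA, of i]
    by (simp add: E_def D_def d_def derivation_def linear_scale)
  have linD: "linear D"
    using der by (simp add: derivation_def)
  note coordD = coord_diag_operator[OF E linD DE]
  have opD: "op_trace D = trace A"
    by (simp add: op_trace_coord[OF E linD] coordD coord_basis[OF E] trd)
  \<comment> \<open>For this squared length of \<open>f\<close> the trace term of the Ricci form is
    \<open>d k / 2\<close>, exactly the bound in \<open>coeff\<close>. Positivity of the trace makes
    it admissible.\<close>
  define h where "h = 2 * trace A"
  have h: "h > 0"
    using tr by (simp add: h_def)
  define g where "g = diag_metric h E"
  have "negative_definite (ricci (semidirect br D) g)"
    unfolding negative_definite_def
  proof (intro allI impI)
    fix y :: "real \<times> 'a"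
    assume "y \<noteq> 0"
    obtain s v where y: "y = (s, v)"
      by (cases y)
    define q where "q = (\<lambda>k. (\<Sum>i\<in>UNIV. \<Sum>j\<in>UNIV. (C i j k)\<^sup>2) / 4
        - (\<Sum>i\<in>UNIV. \<Sum>j\<in>UNIV. (C k i j)\<^sup>2) / 2 - (\<Sum>i\<in>UNIV. d i) * d k / h)"
    have h_half: "(\<Sum>i\<in>UNIV. d i) * d k / h = d k / 2" for k
      using tr by (simp add: h_def trd)
    have q: "q k < 0" for k
      using coeff[of k] unfolding q_def h_half by linarith
    have "ricci (semidirect br D) g y y
        = (\<Sum>k\<in>UNIV. (coord E v k)\<^sup>2 * q k) - s\<^sup>2 * (\<Sum>i\<in>UNIV. (d i)\<^sup>2)"
      unfolding g_def y q_def C_def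
    proof (rule ricci_semidirect_diag[OF L der E h DE]; unfold C_def[symmetric])
      show "k = k'" if "C i j k \<noteq> 0" "C i j k' \<noteq> 0" for i j k k'
        using that nice_basis_target[OF nice] unfolding C0 unfolding c_def by blast
      show "l = l'" if "C l i j \<noteq> 0" "C l' i j \<noteq> 0" for i j l l'
        using that nice_basis_source[OF L nice] unfolding C0 unfolding c_def by blast
      show "C l i j = 0 \<or> C l' j i = 0" for i j l l'
        using nice_basis_acyclic[OF nil nice] C0 unfolding c_def by blast
    qed
    moreover have "(\<Sum>k\<in>UNIV. (coord E v k)\<^sup>2 * q k) \<le> 0"
      using q by (intro sum_nonpos) (simp add: mult_nonneg_nonpos less_imp_le)
    moreover have "(\<Sum>k\<in>UNIV. (coord E v k)\<^sup>2 * q k) < 0" if "v \<noteq> 0"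
    proof -
      obtain k where "coord E v k \<noteq> 0"
        using exists_coord_nonzero[OF E \<open>v \<noteq> 0\<close>] by blast
      then have "0 < (\<Sum>k\<in>UNIV. - ((coord E v k)\<^sup>2 * q k))"
        using q by (intro sum_pos2[where i = k])
          (auto simp: mult_pos_neg mult_nonneg_nonpos less_imp_le)
      then show ?thesis
        by (simp add: sum_negf)
    qed
    \<comment> \<open>This gives strict negativity along \<open>f\<close>: a positive trace forces
      some nonzero diagonal entry.\<close>
    moreover have "(\<Sum>i\<in>UNIV. (d i)\<^sup>2) > 0"
    proof -
      obtain i where "d i \<noteq> 0"
        using tr by (metis trd less_irrefl sum.neutral)
      then show ?thesis
        by (intro sum_pos2[where i = i]) auto
    qed
    then have "s\<^sup>2 * (\<Sum>i\<in>UNIV. (d i)\<^sup>2) \<ge> 0" "s \<noteq> 0 \<Longrightarrow> s\<^sup>2 * (\<Sum>i\<in>UNIV. (d i)\<^sup>2) > 0"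
      by simp_all
    moreover have "s \<noteq> 0 \<or> v \<noteq> 0"
      using \<open>y \<noteq> 0\<close> y by (auto simp: zero_prod_def)
    ultimately show "ricci (semidirect br D) g y y < 0"
      by fastforce
  qed
  moreover have "is_inner_product g"
    unfolding g_def by (rule is_inner_product_diag_metric[OF E h])
  moreover have "g (0, D v) (0, w) = g (0, v) (0, D w)" for v w
    by (simp add: g_def diag_metric_def coordD mult_ac)
  moreover have "g (1, 0) (0, v) = 0" for v
    by (simp add: g_def diag_metric_def linear_0[OF linear_coord[OF E]])
  ultimately have "ricci_negative br D"
    unfolding ricci_negative_def using der opD tr by auto
  then show ?thesis
    using A(2) by (simp add: diag_ricci_negative_def D_def)
qed

theorem corollary3p16:
  fixes br :: "'a::real_vector \<Rightarrow> 'a \<Rightarrow> 'a"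
    and e :: "'n::{finite,linorder} \<Rightarrow> 'a"
  assumes "lie_algebra br" and "nilpotent_lie br" and "nice_basis br e"
  shows "let C = pos_ray_plus (CH br e) pos_diag_matrices \<inter>
                 {D \<in> diag_derivations br e. trace D > 0}
         in openin (top_of_set (diag_derivations br e)) C \<and> convex C \<and> pos_cone C \<and>
            C \<subseteq> diag_ricci_negative br e"
proof -
  define C where "C = pos_ray_plus (CH br e) pos_diag_matrices \<inter>
    {D \<in> diag_derivations br e. trace D > 0}"
  \<comment> \<open>An open set of arbitrary matrices that meets the diagonal derivations exactly in
    \<open>C\<close>. For each \<open>r\<close> and \<open>a\<close> only finitely many strict
    inequalities are imposed, and unions over \<open>r\<close> and \<open>a\<close> stay
    open.\<close>
  define U where "U = (\<Union>r\<in>{0<..}. \<Union>a\<in>CH br e. \<Inter>i. {A :: ((real, 'n) vec, 'n) vec. r * a $ i $ i < A $ i $ i})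
    \<inter> {A. trace A > 0}"
  have sub: "subspace (diag_derivations br e)"
    by (rule subspace_diag_derivations[OF assms(1)])
  have "open U"
    unfolding U_def trace_def
    by (intro open_Int open_UN ballI open_INT finite open_Collect_less continuous_intros)
  moreover have "C = diag_derivations br e \<inter> U"
  proof -
    have "A \<in> C \<longleftrightarrow> A \<in> U" if "A \<in> diag_derivations br e" for A
    proof -
      have "A \<in> diag_matrices"
        using that by (simp add: diag_derivations_def)
      from mem_pos_ray_plus_diag[OF this CH_subset_diag_matrices, of br e] that
      show ?thesis
        by (auto simp: C_def U_def)
    qed
    then show ?thesis
      by (auto simp: C_def)
  qed
  ultimately have "openin (top_of_set (diag_derivations br e)) C"
    by (auto simp: openin_open)
  moreover have "convex C"
  proof -
    have "convex (pos_diag_matrices :: (((real, 'n) vec, 'n) vec) set)"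
    proof (rule convexI)
      fix A B :: "((real, 'n) vec, 'n) vec" and u v :: real
      assume AB: "A \<in> pos_diag_matrices" "B \<in> pos_diag_matrices" and uv: "0 \<le> u" "0 \<le> v" "u + v = 1"
      have "u * A $ i $ i + v * B $ i $ i > 0" for i
        using convexD[OF convex_real_interval(3), of "A $ i $ i" 0 "B $ i $ i" u v] AB uv
        by (auto simp: pos_diag_matrices_def)
      then show "u *\<^sub>R A + v *\<^sub>R B \<in> pos_diag_matrices"
        using AB
        by (simp add: pos_diag_matrices_def subspace_add[OF subspace_diag_matrices]
            subspace_scale[OF subspace_diag_matrices])
    qed
    then have "convex (pos_ray_plus (CH br e) pos_diag_matrices)"
      by (intro convex_pos_ray_plus) (simp_all add: CH_def)
    moreover have "convex {A :: ((real, 'n) vec, 'n) vec. trace A > 0}"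
    proof -
      have "linear (trace :: ((real, 'n) vec, 'n) vec \<Rightarrow> real)"
        by (intro linearI) (simp_all add: trace_def sum.distrib sum_distrib_left)
      from convex_linear_vimage[OF this convex_real_interval(3)[of 0]] show ?thesis
        by (simp add: vimage_def)
    qed
    moreover have "C = pos_ray_plus (CH br e) pos_diag_matrices \<inter> (diag_derivations br e \<inter> {A. trace A > 0})"
      by (auto simp: C_def)
    ultimately show ?thesis
      using subspace_imp_convex[OF sub] by (simp add: convex_Int)
  qed
  moreover have "pos_cone C"
  proof -
    have "pos_cone (pos_diag_matrices :: (((real, 'n) vec, 'n) vec) set)"
      by (auto simp: pos_cone_def pos_diag_matrices_def subspace_scale[OF subspace_diag_matrices])
    from pos_cone_pos_ray_plus[OF this, of "CH br e"] show ?thesis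
      using subspace_scale[OF sub]
      by (auto simp: pos_cone_def C_def trace_def sum_distrib_left[symmetric])
  qed
  moreover have "C \<subseteq> diag_ricci_negative br e"
    using pos_ray_plus_subset_ricci_negative[OF assms] by (auto simp: C_def)
  ultimately show ?thesis
    unfolding Let_def C_def by blast
qed

end
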